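(* Let $q$ be an odd prime power, $m\geq 2$ and $n=\frac{q^m-1}{2}$. Let $\delta_1,\delta_2,\delta_3$ be the first, second and third largest odd coset leaders modulo $q^m-1$, and let $\kappa=\frac{m}{3}$ if $m\equiv 0\pmod 3$ and $\kappa=m$ if $m\not\equiv 0\pmod 3$. Let $\delta$ be an integer. Then the negacyclic BCH code $\mathcal{C}_{(q,n,\delta,0)}$ has parameters $[\frac{q^m-1}{2}, m, \frac{\delta_1+1}{2}]$ if $\frac{\delta_2+3}{2}\leq\delta\leq\frac{\delta_1+1}{2}$, and $[\frac{q^m-1}{2}, m+\kappa, d\geq\frac{\delta_2+1}{2}]$ if $\frac{\delta_3+3}{2}\leq\delta\leq\frac{\delta_2+1}{2}$. Furthermore, if $q^m\geq 25$, the negacyclic BCH code $\mathcal{C}_{(q,n,(\delta_3+1)/2,0)}$ has parameters $[\frac{q^m-1}{2}, 2m+\kappa, d\geq \frac{\delta_3+1}{2}]$.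
   Context: For positive integers $N$ and $0\leq i\leq N-1$, the $q$-cyclotomic coset of $i$ modulo $N$ is $C_i^{(q,N)}=\{i,iq,iq^2,\ldots\}\bmod N\subseteq\mathbb{Z}_N$; its smallest element is its coset leader. An odd coset leader modulo $N$ is a coset leader modulo $N$ which is an odd integer; $\delta_i$ denotes the $i$-th largest one. Negacyclic BCH codes: let $n$ be a positive integer with $\gcd(n,q)=1$, $\ell$ the order of $q$ modulo $2n$, $\alpha$ a primitive element of $\mathrm{GF}(q^\ell)$, $\beta=\alpha^{(q^\ell-1)/(2n)}$ (a primitive $2n$-th root of unity), and $\mathbb{M}_{\beta^{j}}(x)$ the minimal polynomial of $\beta^j$ over $\mathrm{GF}(q)$. For $2\leq\delta\leq n$, $\mathcal{C}_{(q,n,\delta,0)}$ is the negacyclic code of length $n$ over $\mathrm{GF}(q)$, i.e. the ideal of $\mathrm{GF}(q)[x]/(x^n+1)$, generated by $\mathrm{lcm}\big(\mathbb{M}_{\beta^{1}}(x),\mathbb{M}_{\beta^{3}}(x),\ldots,\mathbb{M}_{\beta^{1+2(\delta-2)}}(x)\big)$. Parameters $[n,k,d]$ are length, dimension, minimum Hamming distance. *)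

theory Defs
  imports "HOL-Computational_Algebra.Computational_Algebra" "HOL-Number_Theory.Number_Theory"
begin

definition cyc_coset :: "nat \<Rightarrow> nat \<Rightarrow> nat \<Rightarrow> nat set" where
  "cyc_coset q N i = {(i * q ^ j) mod N | j. True}"

definition is_coset_leader :: "nat \<Rightarrow> nat \<Rightarrow> nat \<Rightarrow> bool" where
  "is_coset_leader q N i \<longleftrightarrow> i < N \<and> i = Min (cyc_coset q N i)"

definition odd_coset_leaders :: "nat \<Rightarrow> nat \<Rightarrow> nat set" where
  "odd_coset_leaders q N = {i. is_coset_leader q N i \<and> odd i}"

definition odd_leader_delta :: "nat \<Rightarrow> nat \<Rightarrow> nat \<Rightarrow> nat" where
  "odd_leader_delta q N k = rev (sorted_list_of_set (odd_coset_leaders q N)) ! (k - 1)"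

definition field_emb :: "('a::field \<Rightarrow> 'b::field) \<Rightarrow> bool" where
  "field_emb e \<longleftrightarrow> inj e \<and> e 0 = 0 \<and> e 1 = 1 \<and>
     (\<forall>x y. e (x + y) = e x + e y) \<and> (\<forall>x y. e (x * y) = e x * e y)"

definition primitive_element :: "'b::{field,finite} \<Rightarrow> bool" where
  "primitive_element a \<longleftrightarrow> (\<forall>x. x \<noteq> 0 \<longrightarrow> (\<exists>k. x = a ^ k))"

definition min_poly :: "('a::field \<Rightarrow> 'b::field) \<Rightarrow> 'b \<Rightarrow> 'a poly" where
  "min_poly e b = (THE p. p \<noteq> 0 \<and> lead_coeff p = 1 \<and> poly (map_poly e p) b = 0 \<and>
      (\<forall>r. r \<noteq> 0 \<and> poly (map_poly e r) b = 0 \<longrightarrow> degree p \<le> degree r))"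

definition negabch_gen :: "('a::field_gcd \<Rightarrow> 'b::field) \<Rightarrow> 'b \<Rightarrow> nat \<Rightarrow> 'a poly" where
  "negabch_gen e \<beta> \<delta> = Lcm {min_poly e (\<beta> ^ (1 + 2 * i)) | i. i \<le> \<delta> - 2}"

text \<open>The ideal of GF(q)[x]/(x^n+1) generated by g, with residues represented by their
  unique representatives of degree < n.\<close>
definition negabch_code :: "('a::field_gcd \<Rightarrow> 'b::field) \<Rightarrow> 'b \<Rightarrow> nat \<Rightarrow> nat \<Rightarrow> 'a poly set" where
  "negabch_code e \<beta> n \<delta> =
     {(negabch_gen e \<beta> \<delta> * a) mod ([:0, 1:] ^ n + 1) | a. True}"

definition hamming_wt :: "'a::zero poly \<Rightarrow> nat" where
  "hamming_wt c = card {i. Polynomial.coeff c i \<noteq> 0}"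

definition min_dist :: "'a::zero poly set \<Rightarrow> nat" where
  "min_dist C = Min {hamming_wt c | c. c \<in> C \<and> c \<noteq> 0}"

definition code_dim :: "'a::field poly set \<Rightarrow> nat" where
  "code_dim C = vector_space.dim (Polynomial.smult :: 'a \<Rightarrow> 'a poly \<Rightarrow> 'a poly) C"

end

theory Submission
  imports Defs
begin

text \<open>
  Put \<open>N = q ^ m - 1 = 2 * n\<close>; then \<open>\<beta>\<close> generates the multiplicative group of the extension
  field. The generator vanishes at \<open>\<beta> ^ i\<close>, \<open>i\<close> odd, exactly if the leader of the coset of \<open>i\<close>
  is at most \<open>2 * \<delta> - 3\<close>, so the dimension is the total size of the cosets of the larger odd
  leaders, and the BCH argument bounds the distance by the smallest of these leaders.

  Complementing \<open>i\<close> to \<open>N - i\<close> turns the largest odd leaders into the smallest odd numbers whose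
  base-\<open>q\<close> digit string is maximal among its rotations. The smallest is \<open>10...0\<close>. A string of
  period \<open>d < m\<close> must repeat an odd number of times by parity; with at least five repetitions
  it exceeds two strings with three digits 1, hence it is not among the first three, and with
  three repetitions the only candidate is \<open>(10...0)(10...0)(10...0)\<close>, which is then the second
  smallest. This gives the coset sizes without determining the second and third leaders in general.

  The exact distance in the first case needs no weight formula: the average weight of the
  \<open>q ^ m - 1\<close> nonzero code words already is at most the BCH bound.
\<close>

section \<open>Large odd coset leaders modulo $q^m - 1$\<close>

text \<open>Multiplication by \<open>q\<close> modulo \<open>q ^ m - 1\<close> rotates
  base-\<open>q\<close> digit strings, so a coset is shorter than \<open>m\<close> only for a
  periodic string. As \<open>q\<close> is odd and \<open>N\<close> even, the parity of a number is
  that of its digit sum and survives rotation; this keeps strings with just two digits 1 out and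
  makes three the least number of repetitions. Only ranks matter: the complement of the k-th largest
  odd leader has exactly k - 1 admissible strings below it. Exhibiting three smaller strings
  therefore discards a periodic one, although the second and third leaders have no uniform formula
  here. The threshold 25 removes a single case, \<open>q = 3\<close>, \<open>m = 2\<close>: the odd
  leaders modulo 8 are 1 and 5, and a third does not exist. Averaging is sharp because
  \<open>N = 2 * n\<close>: the nonzero words of a code of size \<open>q ^ m\<close> have total
  weight at most \<open>n * (q - 1) * q ^ (m - 1)\<close>, hence mean at most
  \<open>(q - 1) * q ^ (m - 1) / 2\<close>. This is the BCH bound, since the largest leader is
  \<open>q ^ m - 1 - q ^ (m - 1)\<close>.\<close>

lemma geometric_sum_nat:
  fixes q :: nat
  assumes "q > 0"
  shows "(q ^ d - 1) * (\<Sum>l<t. q ^ (d * l)) = q ^ (d * t) - 1"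
proof -
  have "(int q ^ d - 1) * (\<Sum>l<t. (int q ^ d) ^ l) = (int q ^ d) ^ t - 1"
    by (metis power_diff_1_eq)
  moreover have "int (q ^ d - 1) = int q ^ d - 1" "int (q ^ (d * t) - 1) = int q ^ (d * t) - 1"
    using assms by (simp_all add: of_nat_diff)
  ultimately have "int ((q ^ d - 1) * (\<Sum>l<t. q ^ (d * l))) = int (q ^ (d * t) - 1)"
    by (simp add: power_mult)
  then show ?thesis
    by linarith
qed

lemma odd_sum_odd_powers:
  fixes q :: nat
  assumes "odd q"
  shows "odd (\<Sum>l<t. q ^ (d * l)) \<longleftrightarrow> odd t"
  by (induction t) (use assms in auto)

lemma three_le_cardI:
  fixes a b c :: nat
  assumes "a < b" "b < c" "finite X" "{a, b, c} \<subseteq> X"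
  shows "3 \<le> card X"
  using card_mono[OF assms(3,4)] assms(1,2) by simp

text \<open>Membership and rank are all that later arguments use of \<open>odd_leader_delta\<close>;
  its list is not unfolded again after this characterisation is applied.\<close>

lemma nth_rev_sorted_list_of_set:
  fixes A :: "'a :: linorder set"
  assumes "finite A" "0 < k" "k \<le> card A"
  defines "x \<equiv> rev (sorted_list_of_set A) ! (k - 1)"
  shows "x \<in> A" and "card {y \<in> A. x < y} = k - 1"
proof -
  define xs where "xs = sorted_list_of_set A"
  have xs: "sorted_wrt (<) xs" "set xs = A" "length xs = card A" "distinct xs"
    using assms(1) by (simp_all add: xs_def)
  define i where "i = card A - k"
  have i: "i < card A" using assms(2,3) by (simp add: i_def)
  have x: "x = xs ! i"
    using assms(2,3) by (simp add: x_def rev_nth i_def xs(3) flip: xs_def)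
  then show "x \<in> A" using i xs(2,3) by (metis nth_mem)
  have lt: "xs ! i < xs ! j \<longleftrightarrow> i < j" if "j < card A" for j
    using xs(1,3) i that by (metis linorder_neqE_nat order_less_asym order_less_irrefl sorted_wrt_nth_less)
  have "{y \<in> A. x < y} = (!) xs ` {i<..<card A}"
    using lt by (auto simp: x in_set_conv_nth xs(3) simp flip: xs(2))
  moreover have "inj_on ((!) xs) {i<..<card A}"
    using xs(3,4) by (auto simp: inj_on_def nth_eq_iff_index_eq)
  ultimately have "card {y \<in> A. x < y} = card {i<..<card A}"
    by (simp add: card_image)
  then show "card {y \<in> A. x < y} = k - 1"
    using assms(2,3) by (simp add: i_def)
qed

section \<open>Rotations of base-q digit strings\<close>

locale odd_cyclotomy =
  fixes q m N :: nat
  assumes q_odd: "odd q" and q_ge: "q \<ge> 3" and m_ge: "m \<ge> 2" and N_def: "N = q ^ m - 1"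
begin

lemma q_pos [simp]: "0 < q"
  using q_ge by simp

lemma one_le_q_power [simp]: "Suc 0 \<le> q ^ j"
  using q_pos by (simp add: Suc_leI)

lemma Suc_N: "N + 1 = q ^ m"
  using N_def q_pos by simp

lemma even_N: "even N"
  using Suc_N q_odd by (metis even_add even_power odd_one)

lemma q_power_ge: "j > 0 \<Longrightarrow> 3 \<le> q ^ j"
  using q_ge by (metis One_nat_def Suc_leI le_trans power_increasing power_one_right q_pos)

lemma q_power_Suc_ge: "3 * q ^ j \<le> q ^ Suc j"
  using q_ge by simp

lemma q_power_lt: "i < j \<Longrightarrow> 3 * q ^ i \<le> q ^ j"
  using q_power_Suc_ge[of i] power_increasing[of "Suc i" j q] q_pos by linarith

lemma q_power_le: "i \<le> j \<Longrightarrow> q ^ i \<le> q ^ j"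
  using one_le_q_power[of 1] by (intro power_increasing) auto

lemma N_ge: "N \<ge> 8"
proof -
  have "3 ^ 2 \<le> q ^ 2" using q_ge by (intro power_mono) auto
  also have "\<dots> \<le> q ^ m" using m_ge by (intro q_power_le)
  finally show ?thesis using Suc_N by simp
qed

lemma coprime_q_N: "coprime (q ^ j) N"
proof -
  have "coprime (q ^ m) N"
    using Suc_N by (metis coprime_Suc_left_nat Suc_eq_plus1)
  then have "coprime q N"
    using m_ge by (simp add: coprime_power_left_iff)
  then show ?thesis by simp
qed

lemma cong_power_m: "[x * q ^ m = x] (mod N)"
proof -
  have "x * q ^ m = x + x * N"
    using Suc_N by (metis add.commute distrib_left mult.right_neutral)
  then show ?thesis by (simp add: cong_def)
qed

text \<open>Complements \<open>N - i\<close> of odd coset leaders \<open>i\<close>: on these the cyclic digit strings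
  to be compared have few nonzero digits.\<close>
definition leader_complements :: "nat set" where
  "leader_complements = {J. odd J \<and> J < N \<and> (\<forall>j. (J * q ^ j) mod N \<le> J)}"

text \<open>\<open>a\<close> and \<open>b\<close> are the upper and the lower block of the digit
  string of \<open>J\<close>. Multiplying by \<open>q ^ (m - s)\<close> modulo \<open>N\<close>
  moves the lower block to the front, and maximality of \<open>J\<close> applies to the result once
  it is known to be reduced.\<close>

lemma rotation_le:
  assumes "J \<in> leader_complements" "s \<le> m" "J = a * q ^ s + b" "b < q ^ s"
  shows "b * q ^ (m - s) + a \<le> J"
proof -
  have JN: "J < N" and rot: "(J * q ^ (m - s)) mod N \<le> J"
    using assms(1) by (auto simp: leader_complements_def)
  have qm: "q ^ s * q ^ (m - s) = q ^ m"
    using assms(2) by (metis le_add_diff_inverse power_add)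
  have "a * q ^ s < q ^ (m - s) * q ^ s"
    using JN assms(3) Suc_N qm by (simp add: mult.commute)
  then have a: "a < q ^ (m - s)" by simp
  have "J * q ^ (m - s) = a * (N + 1) + b * q ^ (m - s)"
    using assms(3) qm Suc_N by (simp add: algebra_simps)
  also have "\<dots> = (b * q ^ (m - s) + a) + a * N" by (simp add: algebra_simps)
  finally have eq: "(J * q ^ (m - s)) mod N = (b * q ^ (m - s) + a) mod N" by simp
  have "(b + 1) * q ^ (m - s) \<le> q ^ s * q ^ (m - s)"
    using assms(4) by (intro mult_right_mono) auto
  then have bnd: "b * q ^ (m - s) + q ^ (m - s) \<le> N + 1"
    using qm Suc_N by (simp add: algebra_simps)
  \<comment> \<open>The value \<open>N\<close> would need all digits equal to \<open>q - 1\<close>,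
    but then \<open>J\<close> itself would be \<open>N\<close>.\<close>
  have "b * q ^ (m - s) + a \<noteq> N"
  proof
    assume *: "b * q ^ (m - s) + a = N"
    then have a': "a + 1 = q ^ (m - s)" using a bnd by simp
    then have "(b + 1) * q ^ (m - s) = q ^ s * q ^ (m - s)"
      using * qm Suc_N by (simp add: algebra_simps)
    then have b': "b + 1 = q ^ s" by (simp only: mult_cancel2) (use q_pos in auto)
    have "J + 1 = (a + 1) * q ^ s" using assms(3) b' by (simp add: algebra_simps)
    then have "J + 1 = q ^ m" unfolding a' using qm by (simp add: mult.commute)
    then show False using JN Suc_N by simp
  qed
  then have "b * q ^ (m - s) + a < N" using a bnd by linarith
  then show ?thesis using eq rot by simp
qed

text \<open>Rotate so that the highest nonzero digit of the low block \<open>b\<close> leads. It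
  contributes at least \<open>q ^ (m - 1)\<close>, while the former leading digit, now inside the
  shifted \<open>a\<close>, still contributes at least \<open>q ^ (m - 1 - s)\<close>.\<close>

lemma low_digit_bound:
  assumes "J \<in> leader_complements" "q ^ (m - 1) \<le> J" "s < m" "J = a * q ^ s + b" "b < q ^ s" "0 < b"
  shows "q ^ (m - 1) + q ^ (m - 1 - s) \<le> J"
proof -
  obtain p where p: "q ^ p \<le> b" "b < q ^ (p + 1)"
    using ex_power_ivl1[of q b] q_ge assms(6) by auto
  have ps: "p < s"
  proof (rule ccontr)
    assume "\<not> p < s"
    then show False using q_power_le[of s p] p(1) assms(5) by simp
  qed
  have qs: "q ^ (s - (p + 1)) * q ^ (p + 1) = q ^ s"
    using ps by (simp only: flip: power_add) simp
  have "J = (a * q ^ (s - (p + 1))) * q ^ (p + 1) + b"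
    using assms(4) qs by (simp add: mult.assoc)
  from rotation_le[OF assms(1) _ this p(2)] ps assms(3)
  have le: "b * q ^ (m - (p + 1)) + a * q ^ (s - (p + 1)) \<le> J" by simp
  have "q ^ p * q ^ (m - (p + 1)) \<le> b * q ^ (m - (p + 1))"
    using p(1) by simp
  moreover have "q ^ p * q ^ (m - (p + 1)) = q ^ (m - 1)"
    using ps assms(3) by (simp flip: power_add)
  moreover have "q ^ (m - 1 - s) \<le> a"
  proof -
    have "q ^ (m - 1 - s) * q ^ s \<le> a * q ^ s + b"
      using assms(2,3,4) by (simp flip: power_add)
    then have "q ^ (m - 1 - s) * q ^ s < (a + 1) * q ^ s"
      using assms(5) by (simp add: algebra_simps)
    then have "q ^ (m - 1 - s) < a + 1" by (simp only: mult_less_cancel2)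
    then show ?thesis by simp
  qed
  moreover have "a \<le> a * q ^ (s - (p + 1))"
    by simp
  ultimately show ?thesis using le by linarith
qed

text \<open>Rotating away the leading zeros gives a number with a nonzero leading digit, which
  maximality puts below \<open>J\<close>.\<close>

lemma leader_complements_ge: 
  assumes "J \<in> leader_complements"
  shows "q ^ (m - 1) \<le> J"
proof -
  have J: "0 < J" "J < N" using assms by (auto simp: leader_complements_def odd_pos)
  obtain p where p: "q ^ p \<le> J" "J < q ^ (p + 1)"
    using ex_power_ivl1[of q J] q_ge J by auto
  have pm: "p < m"
  proof (rule ccontr)
    assume "\<not> p < m"
    then show False using q_power_le[of m p] p(1) J Suc_N by simp
  qed
  have "J * q ^ (m - (p + 1)) + 0 \<le> J"
    by (rule rotation_le[OF assms]) (use pm p in auto)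
  moreover have "q ^ p * q ^ (m - (p + 1)) \<le> J * q ^ (m - (p + 1))"
    using p(1) by simp
  moreover have "q ^ p * q ^ (m - (p + 1)) = q ^ (m - 1)"
    using pm by (simp flip: power_add)
  ultimately show ?thesis by linarith
qed

section \<open>Explicit maximal strings\<close>

lemma leader_complementsI:
  assumes "odd J" "J < N" "J \<in> W" "\<And>x. x \<in> W \<Longrightarrow> x \<le> J" "\<And>x. x \<in> W \<Longrightarrow> (x * q) mod N \<in> W"
  shows "J \<in> leader_complements"
proof -
  have "(J * q ^ j) mod N \<in> W" for j
  proof (induction j)
    case 0
    then show ?case using assms(2,3) by simp
  next
    case (Suc j)
    have "(J * q ^ Suc j) mod N = (((J * q ^ j) mod N) * q) mod N"
      by (simp only: mod_mult_left_eq power_Suc2 mult.assoc)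
    then show ?case using assms(5)[OF Suc] by simp
  qed
  then show ?thesis using assms by (auto simp: leader_complements_def)
qed

text \<open>For positive \<open>a\<close>, \<open>b\<close>, \<open>c\<close> with
  \<open>a + b + c = m\<close> these are the cyclic gaps between the three digits 1, the first of
  which leads. The rotations that begin with a 1 arise by permuting the gaps cyclically.\<close>

definition three_ones :: "nat \<Rightarrow> nat \<Rightarrow> nat \<Rightarrow> nat" where
  "three_ones a b c = q ^ (a + b + c - 1) + q ^ (b + c - 1) + q ^ (c - 1)"

lemma three_ones_eq:
  assumes "c > 0"
  shows "three_ones a b c = (q ^ (a + b) + q ^ b + 1) * q ^ (c - 1)"
  using assms unfolding three_ones_def by (simp add: algebra_simps flip: power_add)

lemma three_ones_shift:
  assumes "c > 0" "a + b + c = m"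
  shows "(three_ones a b c * q) mod N = (q ^ (b + c) + q ^ c + 1) mod N"
proof -
  have "q ^ (c - 1) * q = q ^ c" using assms(1) by (simp add: power_eq_if)
  then have "three_ones a b c * q = q ^ m + q ^ (b + c) + q ^ c"
    unfolding three_ones_eq[OF assms(1)] mult.assoc using assms(2)
    by (simp add: algebra_simps flip: power_add)
  also have "\<dots> = (q ^ (b + c) + q ^ c + 1) + N" using Suc_N by simp
  finally show ?thesis by (simp only: mod_add_self2)
qed

lemma three_ones_lt_N:
  assumes "a > 0" "b > 0" "c > 0" "a + b + c = m"
  shows "three_ones a b c < N"
proof -
  have "3 * q ^ (b + c - 1) \<le> q ^ (a + b + c - 1)" "3 * q ^ (c - 1) \<le> q ^ (b + c - 1)"
    by (rule q_power_lt; use assms in linarith)+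
  moreover have "3 * q ^ (a + b + c - 1) \<le> q ^ m"
    by (rule q_power_lt; use assms m_ge in linarith)
  moreover have "q ^ (c - 1) \<ge> 1" by simp
  ultimately show ?thesis using Suc_N unfolding three_ones_def by linarith
qed

text \<open>The orbit splits into three chains of left shifts, each ending when a 1 reaches the
  leading place. The chain maxima are the three cyclic permutations of the gaps, so two comparisons
  decide maximality.\<close>

lemma three_ones_in_leader_complements:
  assumes abc: "a > 0" "b > 0" "c > 0" "a + b + c = m"
    and le: "three_ones b c a \<le> three_ones a b c" "three_ones c a b \<le> three_ones a b c"
  shows "three_ones a b c \<in> leader_complements"
proof -
  \<comment> \<open>A chain starts with a 1 in the unit place and has \<open>w - 1\<close> further
    shifts before the leading 1 wraps round into the next chain.\<close>
  define X where "X u v w = {(q ^ (u + v) + q ^ v + 1) * q ^ j | j. j < w}" for u v w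
  have X_T: "three_ones u v w \<in> X u v w" if "w > 0" for u v w
    using that unfolding X_def three_ones_eq[OF that] by auto
  have X_le: "x \<le> three_ones u v w" if "x \<in> X u v w" "w > 0" for u v w x
    using that unfolding X_def three_ones_eq[OF that(2)] by (auto intro!: q_power_le mult_left_mono
        simp del: distrib_right distrib_left add_mult_distrib mult_Suc)
  have X_step: "(x * q) mod N \<in> X u v w \<union> X v w u"
    if x: "x \<in> X u v w" and uvw: "u > 0" "v > 0" "w > 0" "u + v + w = m" for u v w x
  proof -
    obtain j where j: "x = (q ^ (u + v) + q ^ v + 1) * q ^ j" "j < w"
      using x unfolding X_def by auto
    show ?thesis
    proof (cases "j + 1 < w")
      case True
      have xq: "x * q = (q ^ (u + v) + q ^ v + 1) * q ^ (j + 1)"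
        using j(1)
        by (simp only: power_Suc2 Suc_eq_plus1[symmetric] mult.assoc)
      then have inX: "x * q \<in> X u v w" using True unfolding X_def by blast
      then have "x * q < N" using X_le[OF inX uvw(3)] three_ones_lt_N[OF uvw] by simp
      then show ?thesis using inX by simp
    next
      case False
      then have "j = w - 1" using j by simp
      then have "x = three_ones u v w" using j three_ones_eq[OF uvw(3)] by simp
      then have *: "(x * q) mod N = (q ^ (v + w) + q ^ w + 1) mod N"
        using three_ones_shift[OF uvw(3,4)] by simp
      have inX: "(q ^ (v + w) + q ^ w + 1) * q ^ 0 \<in> X v w u" using uvw unfolding X_def by blast
      moreover have "q ^ (v + w) + q ^ w + 1 < N"
        using X_le[OF inX uvw(1)] three_ones_lt_N[of v w u] uvw by simp
      ultimately show ?thesis using * by simp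
    qed
  qed
  show ?thesis
  proof (rule leader_complementsI)
    show "odd (three_ones a b c)" using q_odd unfolding three_ones_def by simp
    show "three_ones a b c < N" by (rule three_ones_lt_N) fact+
    show "three_ones a b c \<in> X a b c \<union> X b c a \<union> X c a b" using X_T abc by blast
    show "x \<le> three_ones a b c" if "x \<in> X a b c \<union> X b c a \<union> X c a b" for x
      using that X_le abc le by (meson UnE order_trans)
    show "(x * q) mod N \<in> X a b c \<union> X b c a \<union> X c a b" if "x \<in> X a b c \<union> X b c a \<union> X c a b" for x
      using that X_step[of x a b c] X_step[of x b c a] X_step[of x c a b] abc by (auto simp: add_ac)
  qed
qed

lemma q_power_in_leader_complements: "q ^ (m - 1) \<in> leader_complements"
proof (rule leader_complementsI)
  let ?W = "{q ^ j | j. j < m}"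
  have qm: "3 * q ^ (m - 1) \<le> q ^ m" by (rule q_power_lt) (use m_ge in simp)
  have q1: "q ^ (m - 1) \<ge> 1" by simp
  show "odd (q ^ (m - 1))" using q_odd by simp
  show lt: "q ^ (m - 1) < N" using Suc_N qm q1 by linarith
  show "q ^ (m - 1) \<in> ?W" using m_ge by (intro CollectI exI[of _ "m - 1"]) simp
  show le: "x \<le> q ^ (m - 1)" if "x \<in> ?W" for x using that by (auto intro!: q_power_le)
  show "(x * q) mod N \<in> ?W" if x: "x \<in> ?W" for x
  proof -
    obtain j where j: "x = q ^ j" "j < m" using x by auto
    show ?thesis
    proof (cases "j + 1 < m")
      case True
      then have "q ^ (j + 1) \<in> ?W" by blast
      then show ?thesis using le[of "q ^ (j + 1)"] lt j by (simp add: mult.commute)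
    next
      case False
      then have "x * q = q ^ m" using j by (metis Suc_eq_plus1 Suc_lessI power_Suc2)
      also have "\<dots> = 1 + N" using Suc_N by simp
      finally have "(x * q) mod N = (1 + N) mod N" by (rule arg_cong)
      also have "\<dots> = 1 mod N" by (rule mod_add_self2)
      finally have "(x * q) mod N = q ^ 0" using N_ge by simp
      moreover have "0 < m" using m_ge by simp
      ultimately show ?thesis by blast
    qed
  qed
qed

lemma two_top_in_leader_complements: "2 * q ^ (m - 1) + 1 \<in> leader_complements"
proof (rule leader_complementsI)
  let ?J = "2 * q ^ (m - 1) + 1"
  \<comment> \<open>The string is 20...01; in every other rotation the 1 stands directly before the
    2, which gives the block \<open>q + 2\<close>.\<close>
  let ?W = "insert ?J {(q + 2) * q ^ j | j. j < m - 1}"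
  have qm: "3 * q ^ (m - 1) \<le> q ^ m" by (rule q_power_lt) (use m_ge in simp)
  have q1: "3 \<le> q ^ (m - 1)" by (rule q_power_ge) (use m_ge in simp)
  have top: "(q + 2) * q ^ (m - 2) = q ^ (m - 1) + 2 * q ^ (m - 2)"
  proof -
    have "q ^ (m - 1) = q * q ^ (m - 2)"
      using m_ge by (metis Suc_1 Suc_diff_Suc Suc_le_lessD power_Suc One_nat_def)
    then show ?thesis by (simp add: algebra_simps)
  qed
  have top2: "3 * q ^ (m - 2) \<le> q ^ (m - 1)" by (rule q_power_lt) (use m_ge in simp)
  show "odd ?J" by simp
  show lt: "?J < N" using Suc_N qm q1 by linarith
  show "?J \<in> ?W" by simp
  show le: "x \<le> ?J" if x: "x \<in> ?W" for x
  proof (cases "x = ?J")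
    case False
    then obtain j where j: "x = (q + 2) * q ^ j" "j < m - 1" using x by auto
    have "x \<le> (q + 2) * q ^ (m - 2)"
      unfolding j(1) by (intro mult_left_mono q_power_le) (use j in auto)
    then show ?thesis using top top2 by linarith
  qed simp
  show "(x * q) mod N \<in> ?W" if x: "x \<in> ?W" for x
  proof (cases "x = ?J")
    case True
    have "q * q ^ (m - 1) = q ^ m" using m_ge by (simp add: power_eq_if)
    then have "x * q = 2 * q ^ m + q" using True by (simp add: algebra_simps)
    also have "\<dots> = (q + 2) + 2 * N" using Suc_N by simp
    finally have *: "(x * q) mod N = (q + 2) mod N" by (simp only: mod_mult_self1)
    have "(q + 2) * q ^ 0 \<in> {(q + 2) * q ^ j | j. j < m - 1}"
      by (intro CollectI exI[of _ 0]) (use m_ge in simp)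
    then have "(q + 2) * q ^ 0 \<in> ?W" by (rule insertI2)
    moreover from le[OF this] have "q + 2 < N" using lt by simp
    ultimately show ?thesis using * by simp
  next
    case False
    then obtain j where j: "x = (q + 2) * q ^ j" "j < m - 1" using x by auto
    show ?thesis
    proof (cases "j + 1 < m - 1")
      case True
      then have "(q + 2) * q ^ (j + 1) \<in> ?W" by blast
      moreover from le[OF this] have "(q + 2) * q ^ (j + 1) < N" using lt by simp
      moreover have "x * q = (q + 2) * q ^ (j + 1)" using j(1)
        by (simp only: power_Suc2 Suc_eq_plus1[symmetric] mult.assoc)
      ultimately show ?thesis by simp
    next
      case False
      then have "j = m - 2" using j by simp
      then have "x * q = (q ^ (m - 1) + 2 * q ^ (m - 2)) * q" using j top by simp
      also have "\<dots> = q ^ m + 2 * q ^ (m - 1)"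
        using m_ge by (simp add: algebra_simps power_eq_if)
      also have "\<dots> = ?J + N" using Suc_N by simp
      finally have "(x * q) mod N = (?J + N) mod N" by (rule arg_cong)
      also have "\<dots> = ?J mod N" by (rule mod_add_self2)
      finally have "(x * q) mod N = ?J" using lt by simp
      then show ?thesis by simp
    qed
  qed
qed

text \<open>With \<open>m = 2\<close> there is no room for three digits 1. The string 30 serves as
  third witness, and \<open>q \<ge> 5\<close> makes 3 a digit.\<close>

lemma three_q_in_leader_complements:
  assumes "m = 2" "q \<ge> 5"
  shows "3 * q \<in> leader_complements"
proof (rule leader_complementsI)
  have N: "N + 1 = q * q" using Suc_N assms by (simp add: power2_eq_square)
  have q5: "5 * q \<le> q * q" using assms by simp
  show "odd (3 * q)" using q_odd by simp
  show lt: "3 * q < N" using N q5 q_ge by linarith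
  show "3 * q \<in> {3, 3 * q}" by simp
  show "x \<le> 3 * q" if "x \<in> {3, 3 * q}" for x using that q_ge by auto
  have "3 * q * q = 3 + 3 * N" using N by linarith
  then have "(3 * q * q) mod N = (3 + 3 * N) mod N" by (rule arg_cong)
  also have "\<dots> = 3 mod N" by (rule mod_mult_self1)
  finally have "(3 * q * q) mod N = 3" using N_ge by simp
  then show "(x * q) mod N \<in> {3, 3 * q}" if "x \<in> {3, 3 * q}" for x
    using that lt by auto
qed

section \<open>Periodic strings among the smallest ones\<close>

lemma finite_leader_complements: "finite leader_complements"
  by (rule finite_subset[of _ "{..<N}"]) (auto simp: leader_complements_def)

text \<open>The divisibility \<open>per\<close> says that rotation by \<open>d\<close> places fixes
  \<open>J\<close>. The bound 3 is what excludes the first three ranks, whose strings have at most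
  two members below them.\<close>

lemma periodic_cases:
  assumes J: "J \<in> leader_complements" and d: "d dvd m" "0 < d" "d < m" and per: "N dvd J * (q ^ d - 1)"
  shows "(m = 3 * d \<and> J = three_ones d d d) \<or> 3 \<le> card {J' \<in> leader_complements. J' < J}"
proof -
  obtain t where t: "m = d * t" using d(1) by (elim dvdE)
  \<comment> \<open>\<open>M\<close> has digits 1 exactly at the multiples of \<open>d\<close>, so
    \<open>J = w * M\<close> is the block \<open>w\<close> of length \<open>d\<close> written
    \<open>t\<close> times.\<close>
  define M where "M = (\<Sum>l<t. q ^ (d * l))"
  have NM: "(q ^ d - 1) * M = N"
    using geometric_sum_nat[OF q_pos] t N_def unfolding M_def by metis
  have G: "q ^ d - 1 > 0" using q_power_ge[OF d(2)] by simp
  have "(q ^ d - 1) * M dvd (q ^ d - 1) * J" using per NM by (simp add: mult.commute)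
  then have "M dvd J" using G by simp
  then obtain w where w: "J = w * M" by (metis dvd_def mult.commute)
  have "odd J" using J by (simp add: leader_complements_def)
  then have "odd M" "odd w" using w by auto
  then have "odd t" using odd_sum_odd_powers[OF q_odd] unfolding M_def by blast
  moreover have "t \<ge> 2" using t d by (metis One_nat_def Suc_leI Suc_1 mult.right_neutral mult_0_right
        nat_less_le not_less_eq_eq not_less0 le_SucE le_0_eq)
  ultimately have "t = 3 \<or> t \<ge> 5" by presburger
  \<comment> \<open>The leading digit of \<open>J\<close> is nonzero, and it is the leading digit of
    the block.\<close>
  have w_ge: "q ^ (d - 1) \<le> w"
  proof (rule ccontr)
    assume "\<not> q ^ (d - 1) \<le> w"
    then have "(w + 1) * q \<le> q ^ (d - 1) * q" by (intro mult_right_mono) auto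
    also have "\<dots> = q ^ d" using d(2) by (simp add: power_eq_if)
    finally have "w * q \<le> q ^ d - 1" using q_ge by (simp add: algebra_simps)
    then have "w * q * M \<le> N" unfolding NM[symmetric] by (rule mult_right_mono) simp
    moreover have "q ^ (m - 1) * q \<le> w * M * q" using leader_complements_ge[OF J] w by (intro mult_right_mono) auto
    moreover have "q ^ (m - 1) * q = q ^ m" using m_ge by (simp add: power_eq_if)
    moreover have "w * M * q = w * q * M" by simp
    ultimately have "q ^ m \<le> N" by linarith
    then show False using Suc_N by simp
  qed
  have fin: "finite {J' \<in> leader_complements. J' < J}" using finite_leader_complements by simp
  have min_in: "q ^ (m - 1) \<in> leader_complements" by (rule q_power_in_leader_complements)
  from \<open>t = 3 \<or> t \<ge> 5\<close> show ?thesis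
  proof
    assume t3: "t = 3"
    have m3: "m = 3 * d" using t t3 by simp
    have M: "M = q ^ (d + d) + q ^ d + 1"
      unfolding M_def t3 by (simp add: numeral_3_eq_3 mult_2_right)
    have TJ: "three_ones d d d = q ^ (d - 1) * M"
      unfolding three_ones_eq[OF d(2)] M by simp
    have Tv: "three_ones d d d = q ^ (m - 1) + q ^ (2 * d - 1) + q ^ (d - 1)"
      using m3 by (simp add: three_ones_def mult_2 numeral_3_eq_3 add.assoc)
    show ?thesis
    proof (cases "w = q ^ (d - 1)")
      case True
      then show ?thesis using TJ w m3 by simp
    next
      case False
      then have w1: "q ^ (d - 1) + 1 \<le> w" using w_ge by simp
      have "three_ones d d d + M = (q ^ (d - 1) + 1) * M" using TJ by (simp add: algebra_simps)
      also have "\<dots> \<le> J" unfolding w using w1 by (rule mult_right_mono) simp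
      finally have J_ge: "three_ones d d d + M \<le> J" .
      have T_S: "three_ones d d d \<in> leader_complements" by (rule three_ones_in_leader_complements) (use d m3 in auto)
      \<comment> \<open>Together with 10...0 and the diagonal string, one more member strictly
        between the diagonal string and \<open>J\<close> gives three.\<close>
      have "\<exists>X\<in>leader_complements. three_ones d d d < X \<and> X < J"
      proof (cases "d = 1")
        case True
        \<comment> \<open>For blocks of one digit, parity lifts \<open>w\<close> from 2 to 3, which
          leaves room for 201 between 111 and \<open>J\<close>.\<close>
        have "w \<noteq> 2" using \<open>odd w\<close> by auto
        then have "3 \<le> w" using w1 True by simp
        then have "3 * M \<le> J" unfolding w by (rule mult_right_mono) simp
        moreover have "M = q ^ 2 + q + 1" using M True by (simp add: numeral_2_eq_2)
        moreover have "m - 1 = 2" using m3 True by simp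
        moreover have "three_ones d d d = q ^ 2 + q + 1" using TJ True M by (simp add: numeral_2_eq_2)
        moreover have "q < q ^ 2" using q_ge by (simp add: power2_eq_square)
        ultimately show ?thesis using two_top_in_leader_complements by (intro bexI[of _ "2 * q ^ (m - 1) + 1"]) auto
      next
        case False
        \<comment> \<open>The middle 1 of the diagonal string is moved up one place. This stays
          below \<open>J\<close>, because \<open>J\<close> exceeds the diagonal string by at least
          \<open>M\<close>, which contains \<open>q ^ (d + d)\<close>.\<close>
        have X: "three_ones (d - 1) (d + 1) d = q ^ (m - 1) + q ^ (2 * d) + q ^ (d - 1)"
        proof -
          have "d - 1 + (d + 1) + d - 1 = m - 1" "d + 1 + d - 1 = 2 * d" using m3 by simp_all
          then show ?thesis unfolding three_ones_def by (simp only:)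
        qed
        have X2: "three_ones (d + 1) d (d - 1) = q ^ (m - 1) + q ^ (2 * d - 2) + q ^ (d - 2)"
        proof -
          have "d + 1 + d + (d - 1) - 1 = m - 1" "d + (d - 1) - 1 = 2 * d - 2" "d - 1 - 1 = d - 2"
            using m3 d(2) by simp_all
          then show ?thesis unfolding three_ones_def by simp
        qed
        have X3: "three_ones d (d - 1) (d + 1) = q ^ (m - 1) + q ^ (2 * d - 1) + q ^ d"
        proof -
          have "d + (d - 1) + (d + 1) - 1 = m - 1" "d - 1 + (d + 1) - 1 = 2 * d - 1"
            using m3 d(2) by simp_all
          then show ?thesis unfolding three_ones_def by simp
        qed
        have b1: "3 * q ^ (2 * d - 1) \<le> q ^ (2 * d)" by (rule q_power_lt) (use d in simp)
        have b2: "q ^ d \<le> q ^ (2 * d - 1)" by (rule q_power_le) (use d in simp)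
        have b3: "q ^ (2 * d - 2) \<le> q ^ (2 * d - 1)" "q ^ (d - 2) \<le> q ^ (d - 1)"
          by (rule q_power_le; simp)+
        have p: "q ^ (2 * d - 1) > 0" using q_pos by simp
        have "three_ones (d - 1) (d + 1) d \<in> leader_complements"
        proof (rule three_ones_in_leader_complements)
          show "three_ones (d + 1) d (d - 1) \<le> three_ones (d - 1) (d + 1) d" unfolding X X2 using b1 b3 by linarith
          show "three_ones d (d - 1) (d + 1) \<le> three_ones (d - 1) (d + 1) d" unfolding X X3 using b1 b2 by linarith
        qed (use False d m3 in auto)
        moreover have "three_ones d d d < three_ones (d - 1) (d + 1) d" unfolding X Tv using b1 p by linarith
        moreover have "three_ones (d - 1) (d + 1) d < J"
          using J_ge unfolding X Tv M using p by (simp add: mult_2)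
        ultimately show ?thesis by blast
      qed
      then obtain X where X: "X \<in> leader_complements" "three_ones d d d < X" "X < J" by blast
      have lt: "q ^ (m - 1) < three_ones d d d" unfolding Tv using q_pos by simp
      moreover have "three_ones d d d < J" using X by simp
      ultimately have "q ^ (m - 1) < J" by (rule order_less_trans)
      then have "3 \<le> card {J' \<in> leader_complements. J' < J}"
        using X T_S min_in by (intro three_le_cardI[OF lt X(2) fin]) auto
      then show ?thesis ..
    qed
  next
    assume t5: "t \<ge> 5"
    then obtain r where r: "t = Suc (Suc (Suc (Suc r)))" "r \<ge> 1"
      by (intro that[of "t - 4"]) auto
    have m5: "5 * d \<le> m" using t t5 by (simp add: mult.commute)
    have "q ^ (d * (r + 3)) + q ^ (d * (r + 2)) + q ^ (d * (r + 1)) + q ^ (d * r) \<le> M"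
      unfolding M_def r(1) by (simp add: numeral_eq_Suc)
    then have "q ^ (d - 1) * (q ^ (d * (r + 3)) + q ^ (d * (r + 2)) + q ^ (d * (r + 1)) + q ^ (d * r)) \<le> J"
      unfolding w using w_ge by (intro mult_mono) auto
    moreover have "d - 1 + d * (r + 3) = m - 1" "d - 1 + d * (r + 2) = m - d - 1"
      "d - 1 + d * (r + 1) = m - 2 * d - 1"
      using d(2) unfolding t r(1) by (simp_all add: algebra_simps)
    ultimately have "q ^ (m - 1) + q ^ (m - d - 1) + q ^ (m - 2 * d - 1) + q ^ (d - 1 + d * r) \<le> J"
      by (simp add: distrib_left flip: power_add)
    moreover have "0 < q ^ (d - 1 + d * r)" using q_pos by simp
    ultimately have J_gt: "q ^ (m - 1) + q ^ (m - d - 1) + q ^ (m - 2 * d - 1) < J" by linarith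
    \<comment> \<open>\<open>?U\<close> keeps the three highest digits 1 guaranteed in
      \<open>J\<close>, so a further repetition makes \<open>J\<close> strictly larger;
      \<open>?V\<close> lowers the last 1 of \<open>?U\<close> by one place. Five repetitions make
      the final gap long enough for both to be maximal.\<close>
    let ?U = "three_ones d d (m - 2 * d)" and ?V = "three_ones d (d + 1) (m - 2 * d - 1)"
    have U: "?U = q ^ (m - 1) + q ^ (m - d - 1) + q ^ (m - 2 * d - 1)"
      using m5 d(2) unfolding three_ones_def by (simp add: mult_2)
    have V: "?V = q ^ (m - 1) + q ^ (m - d - 1) + q ^ (m - 2 * d - 2)"
      using m5 d(2) unfolding three_ones_def by (simp add: mult_2)
    have "?U \<in> leader_complements"
    proof (rule three_ones_in_leader_complements)
      have "three_ones d (m - 2 * d) d = q ^ (m - 1) + q ^ (m - d - 1) + q ^ (d - 1)"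
        using m5 d(2) unfolding three_ones_def by (simp add: mult_2)
      moreover have d1: "q ^ (d - 1) \<le> q ^ (m - 2 * d - 1)" by (rule q_power_le) (use m5 in simp)
      ultimately show "three_ones d (m - 2 * d) d \<le> ?U" unfolding U by simp
      have "three_ones (m - 2 * d) d d = q ^ (m - 1) + q ^ (2 * d - 1) + q ^ (d - 1)"
        using m5 d(2) unfolding three_ones_def by (simp add: mult_2)
      moreover have "q ^ (2 * d - 1) \<le> q ^ (m - d - 1)" by (rule q_power_le) (use m5 in simp)
      ultimately show "three_ones (m - 2 * d) d d \<le> ?U" unfolding U using d1 by simp
    qed (use m5 d in auto)
    moreover have "?V \<in> leader_complements"
    proof (rule three_ones_in_leader_complements)
      have "three_ones (d + 1) (m - 2 * d - 1) d = q ^ (m - 1) + q ^ (m - d - 2) + q ^ (d - 1)"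
        using m5 d(2) unfolding three_ones_def by (simp add: mult_2 numeral_eq_Suc)
      moreover have "q ^ (d - 1) \<le> q ^ (m - 2 * d - 2)" by (rule q_power_le) (use m5 d in simp)
      moreover have "q ^ (m - d - 2) \<le> q ^ (m - d - 1)" by (rule q_power_le) simp
      ultimately show "three_ones (d + 1) (m - 2 * d - 1) d \<le> ?V" unfolding V by simp
      have "three_ones (m - 2 * d - 1) d (d + 1) = q ^ (m - 1) + q ^ (2 * d) + q ^ d"
        using m5 d(2) unfolding three_ones_def by (simp add: mult_2)
      moreover have "q ^ (2 * d) \<le> q ^ (m - d - 1)" by (rule q_power_le) (use m5 d in simp)
      moreover have "q ^ d \<le> q ^ (m - 2 * d - 2)" by (rule q_power_le) (use m5 d in simp)
      ultimately show "three_ones (m - 2 * d - 1) d (d + 1) \<le> ?V" unfolding V by simp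
    qed (use m5 d in auto)
    moreover have "?V < ?U"
    proof -
      have "3 * q ^ (m - 2 * d - 2) \<le> q ^ (m - 2 * d - 1)" by (rule q_power_lt) (use m5 d in simp)
      moreover have "0 < q ^ (m - 2 * d - 2)" using q_pos by simp
      ultimately show ?thesis unfolding U V by linarith
    qed
    moreover have "?U < J" using J_gt U by simp
    moreover have "q ^ (m - 1) < ?V" unfolding V using q_pos by simp
    ultimately have "3 \<le> card {J' \<in> leader_complements. J' < J}"
      by (intro three_le_cardI[of "q ^ (m - 1)" ?V ?U, OF _ _ fin]) (use min_in in auto)
    then show ?thesis ..
  qed
qed

text \<open>Removing the leading 1 and then one unit of the highest remaining digit leaves an odd,
  hence nonzero, remainder \<open>r'\<close>. It is confined to the lowest \<open>k - 1\<close>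
  places, and then \<open>low_digit_bound\<close> forces a contribution \<open>q ^ (2 * k)\<close>,
  too large below the diagonal string.\<close>

lemma below_three_ones_diagonal:
  assumes J: "J \<in> leader_complements" "J < three_ones k k k" and k: "m = 3 * k"
  shows "J = q ^ (m - 1)"
proof (rule ccontr)
  assume neq: "J \<noteq> q ^ (m - 1)"
  have k0: "k > 0" using k m_ge by simp
  have Tv: "three_ones k k k = q ^ (m - 1) + q ^ (2 * k - 1) + q ^ (k - 1)"
    using k by (simp add: three_ones_def mult_2 numeral_3_eq_3 add.assoc)
  define r where "r = J - q ^ (m - 1)"
  have Jr: "J = q ^ (m - 1) + r" "r > 0" using leader_complements_ge[OF J(1)] neq by (auto simp: r_def)
  have rlt: "r < q ^ (2 * k - 1) + q ^ (k - 1)" using Jr J(2) Tv by simp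
  have b1: "q ^ (k - 1) \<le> q ^ (2 * k - 1)" by (rule q_power_le) simp
  have b2: "3 * q ^ (2 * k - 1) \<le> q ^ (2 * k)" by (rule q_power_lt) (use k0 in simp)
  have b3: "0 < q ^ (2 * k - 1)" using q_pos by simp
  obtain p where p: "q ^ p \<le> r" "r < q ^ (p + 1)"
    using ex_power_ivl1[of q r] q_ge Jr by auto
  have p2k: "p < 2 * k"
  proof (rule ccontr)
    assume "\<not> p < 2 * k"
    then have "q ^ (2 * k) \<le> q ^ p" by (intro q_power_le) simp
    then show False using p rlt b1 b2 b3 by linarith
  qed
  define r' where "r' = r - q ^ p"
  have rr': "r = q ^ p + r'" using p by (simp add: r'_def)
  have "odd J" using J by (simp add: leader_complements_def)
  then have "odd r'" using Jr rr' q_odd by simp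
  then have r'0: "0 < r'" by (simp add: odd_pos)
  \<comment> \<open>If \<open>p = 2 * k - 1\<close>, the bound on \<open>r\<close> suffices.
    Otherwise rotating \<open>r\<close> to the front shifts \<open>r'\<close> by at least
    \<open>k + 1\<close> places, and the result must still be below the diagonal string.\<close>
  have r'lt: "r' < q ^ (k - 1)"
  proof (cases "p = 2 * k - 1")
    case True
    then show ?thesis using rr' rlt by simp
  next
    case False
    then have p': "p + 1 < 2 * k" using p2k by simp
    have "J = q ^ (m - 1 - (p + 1)) * q ^ (p + 1) + r"
    proof -
      have "q ^ (m - 1 - (p + 1)) * q ^ (p + 1) = q ^ (m - 1)"
        by (simp only: flip: power_add) (rule arg_cong[of _ _ "\<lambda>x. q ^ x"], use p' k in simp)
      then show ?thesis using Jr by simp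
    qed
    from rotation_le[OF J(1) _ this p(2)] p' k
    have "r * q ^ (m - (p + 1)) \<le> J" by simp
    then have "(q ^ p + r') * q ^ (m - (p + 1)) < q ^ (m - 1) + q ^ (2 * k - 1) + q ^ (k - 1)"
      using J(2) Tv rr' by simp
    moreover have "q ^ p * q ^ (m - (p + 1)) = q ^ (m - 1)"
      using p' k by (simp flip: power_add)
    ultimately have "r' * q ^ (m - (p + 1)) < q ^ (2 * k - 1) + q ^ (k - 1)"
      by (simp add: distrib_right)
    moreover have "r' * q ^ (k + 1) \<le> r' * q ^ (m - (p + 1))"
      by (intro mult_left_mono q_power_le) (use p' k in auto)
    ultimately have "r' * q ^ (k + 1) < q ^ (2 * k)" using b1 b2 b3 by linarith
    also have "q ^ (2 * k) = q ^ (k - 1) * q ^ (k + 1)"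
      by (simp only: flip: power_add) (rule arg_cong[of _ _ "\<lambda>x. q ^ x"], use k0 in simp)
    finally show ?thesis by (simp only: mult_less_cancel2)
  qed
  have e: "(q ^ (m - 1 - (k - 1)) + a) * q ^ (k - 1) = q ^ (m - 1) + a * q ^ (k - 1)" for a
  proof -
    have "q ^ (m - 1 - (k - 1)) * q ^ (k - 1) = q ^ (m - 1)"
      by (simp only: flip: power_add) (rule arg_cong[of _ _ "\<lambda>x. q ^ x"], use k in simp)
    then show ?thesis by (simp only: distrib_right)
  qed
  obtain a where "J = a * q ^ (k - 1) + r'"
  proof (cases "k - 1 \<le> p")
    case True
    then have "q ^ p = q ^ (p - (k - 1)) * q ^ (k - 1)" by (simp flip: power_add)
    then have "J = (q ^ (m - 1 - (k - 1)) + q ^ (p - (k - 1))) * q ^ (k - 1) + r'"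
      unfolding e using Jr rr' by simp
    then show ?thesis by (rule that)
  next
    case False
    then have "q ^ (p + 1) \<le> q ^ (k - 1)" by (intro q_power_le) simp
    then have "r < q ^ (k - 1)" using p by simp
    moreover have "J = q ^ (m - 1 - (k - 1)) * q ^ (k - 1) + r" using Jr e[of 0] by simp
    ultimately have "q ^ (m - 1) + q ^ (m - 1 - (k - 1)) \<le> J"
      by (intro low_digit_bound[OF J(1) leader_complements_ge[OF J(1)], of "k - 1" "q ^ (m - 1 - (k - 1))" r])
         (use Jr k k0 in auto)
    moreover have "m - 1 - (k - 1) = 2 * k" using k k0 by simp
    ultimately show ?thesis using Jr rlt b1 b2 b3 by simp
  qed
  then have "q ^ (m - 1) + q ^ (m - 1 - (k - 1)) \<le> J"
    by (intro low_digit_bound[OF J(1) leader_complements_ge[OF J(1)]]) (use r'0 r'lt k k0 in auto)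
  moreover have "m - 1 - (k - 1) = 2 * k" using k k0 by simp
  ultimately show False using Jr rlt b1 b2 b3 by simp
qed

text \<open>\<open>N - 1\<close> is the complement of 1, so this puts three odd leaders above 1. The
  witnesses are 10, 21, 30 for \<open>m = 2\<close>, and 10...0, 1110...0, 20...01
  otherwise.\<close>

lemma card_leader_complements_ge:
  assumes "25 \<le> q ^ m"
  shows "3 \<le> card {J \<in> leader_complements. J < N - 1}"
proof -
  have fin: "finite {J \<in> leader_complements. J < N - 1}" using finite_leader_complements by simp
  let ?a = "q ^ (m - 1)" and ?b = "2 * q ^ (m - 1) + 1"
  have top: "3 * ?a \<le> q ^ m" by (rule q_power_lt) (use m_ge in simp)
  have a0: "?a > 0" using q_pos by simp
  show ?thesis
  proof (cases "m = 2")
    case True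
    have "q \<noteq> 3" using assms True by auto
    then have q5: "q \<ge> 5" using q_ge q_odd by presburger
    have "5 * q \<le> q * q" using q5 by simp
    moreover have "N + 1 = q * q" using Suc_N True by (simp add: power2_eq_square)
    ultimately have "3 * q < N - 1" using q5 by linarith
    then show ?thesis
      using three_q_in_leader_complements[OF True q5] q_power_in_leader_complements two_top_in_leader_complements q5 True
      by (intro three_le_cardI[of ?a ?b "3 * q", OF _ _ fin]) auto
  next
    case False
    then have m3: "m \<ge> 3" using m_ge by simp
    let ?c = "three_ones 1 1 (m - 2)"
    have c: "?c = ?a + q ^ (m - 2) + q ^ (m - 3)"
    proof -
      have "1 + 1 + (m - 2) - 1 = m - 1" "1 + (m - 2) - 1 = m - 2" "m - 2 - 1 = m - 3"
        using m3 by simp_all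
      then show ?thesis unfolding three_ones_def by simp
    qed
    have c1: "3 * q ^ (m - 2) \<le> ?a" "3 * q ^ (m - 3) \<le> q ^ (m - 2)"
      by (rule q_power_lt; use m3 in simp)+
    have c0: "0 < q ^ (m - 2)" "0 < q ^ (m - 3)" using q_pos by simp_all
    have "?c \<in> leader_complements"
    proof (rule three_ones_in_leader_complements)
      have "three_ones 1 (m - 2) 1 = ?a + q ^ (m - 2) + 1"
      proof -
        have "1 + (m - 2) + 1 - 1 = m - 1" "m - 2 + 1 - 1 = m - 2" using m3 by simp_all
        then show ?thesis unfolding three_ones_def by simp
      qed
      then show "three_ones 1 (m - 2) 1 \<le> ?c" unfolding c using c0 by simp
      have "three_ones (m - 2) 1 1 = ?a + q + 1"
      proof -
        have "m - 2 + 1 + 1 - 1 = m - 1" using m3 by simp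
        then show ?thesis unfolding three_ones_def by simp
      qed
      moreover have "q \<le> q ^ (m - 2)" using q_power_le[of 1 "m - 2"] m3 by simp
      ultimately show "three_ones (m - 2) 1 1 \<le> ?c" unfolding c using c0 by linarith
    qed (use m3 in auto)
    moreover have "?a < ?c" "?c < ?b" unfolding c using c1 c0 by linarith+
    moreover have "?b < N - 1" using top Suc_N c1 c0 by linarith
    ultimately show ?thesis
      by (intro three_le_cardI[of ?a ?c ?b, OF _ _ fin]) (use q_power_in_leader_complements two_top_in_leader_complements in auto)
  qed
qed

section \<open>Cosets, leaders and complements\<close>

abbreviation C :: "nat \<Rightarrow> nat set" where "C \<equiv> cyc_coset q N"
abbreviation A :: "nat set" where "A \<equiv> odd_coset_leaders q N"

lemma N_pos: "N > 0"
  using N_ge by simp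

lemma coset_subset: "C i \<subseteq> {..<N}"
  using N_pos by (auto simp: cyc_coset_def)

lemma finite_coset: "finite (C i)"
  using coset_subset finite_subset by blast

lemma coset_refl: "i < N \<Longrightarrow> i \<in> C i"
  unfolding cyc_coset_def by (auto intro!: exI[of _ 0])

lemma coset_trans: "i \<in> C j \<Longrightarrow> j \<in> C k \<Longrightarrow> i \<in> C k"
  unfolding cyc_coset_def
  by (auto simp: mod_mult_left_eq mult.assoc simp flip: power_add)

text \<open>After \<open>s\<close> rotations, \<open>s * (m - 1)\<close> more complete
  \<open>s\<close> full turns.\<close>

lemma coset_sym:
  assumes "i \<in> C j" "j < N"
  shows "j \<in> C i"
proof -
  obtain s where s: "i = (j * q ^ s) mod N" using assms by (auto simp: cyc_coset_def)
  have *: "(x * q ^ (m * k)) mod N = x mod N" for x k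
  proof (induction k)
    case (Suc k)
    have "x * q ^ (m * Suc k) = (x * q ^ (m * k)) * q ^ m" by (simp add: power_add mult_ac)
    also have "\<dots> mod N = (x * q ^ (m * k)) mod N"
      using cong_power_m[of "x * q ^ (m * k)"] by (simp only: cong_def)
    finally show ?case using Suc by (rule trans)
  qed simp
  have "s + s * (m - 1) = m * s" using m_ge by (cases m) simp_all
  then have "(i * q ^ (s * (m - 1))) mod N = (j * q ^ (m * s)) mod N"
    unfolding s by (simp add: mod_mult_left_eq mult.assoc flip: power_add)
  also have "\<dots> = j" using * assms(2) by simp
  finally show ?thesis unfolding cyc_coset_def by blast
qed

lemma coset_odd:
  assumes "i \<in> C j"
  shows "odd i \<longleftrightarrow> odd j"
proof -
  obtain s where s: "i = (j * q ^ s) mod N" using assms by (auto simp: cyc_coset_def)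
  have "odd ((j * q ^ s) mod N) \<longleftrightarrow> odd (j * q ^ s)"
    using even_N by (metis dvd_mod_iff)
  then show ?thesis using s q_odd by simp
qed

lemma coset_power_closed: "i \<in> C j \<Longrightarrow> (i * q) mod N \<in> C j"
  by (rule coset_trans) (auto simp: cyc_coset_def intro: exI[of _ 1])

lemma odd_leader_iff: "i \<in> A \<longleftrightarrow> odd i \<and> i < N \<and> (\<forall>s. i \<le> (i * q ^ s) mod N)"
proof -
  have "i = Min (C i) \<longleftrightarrow> (\<forall>x\<in>C i. i \<le> x)" if "i < N"
    using finite_coset coset_refl[OF that]
    by (metis Min_eqI Min_le empty_iff eq_Min_iff)
  then show ?thesis
    by (auto simp: odd_coset_leaders_def is_coset_leader_def cyc_coset_def)
qed

lemma odd_leader_le: "l \<in> A \<Longrightarrow> x \<in> C l \<Longrightarrow> l \<le> x"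
  by (auto simp: odd_leader_iff cyc_coset_def)

lemma finite_odd_leaders: "finite A"
  by (rule finite_subset[of _ "{..<N}"]) (auto simp: odd_leader_iff)

lemma ex_leader:
  assumes "odd i" "i < N"
  shows "\<exists>l\<in>A. i \<in> C l \<and> l \<in> C i"
proof -
  define l where "l = Min (C i)"
  have l: "l \<in> C i" unfolding l_def using finite_coset coset_refl[OF assms(2)] by (intro Min_in) auto
  have lN: "l < N" using l coset_subset by blast
  have "l \<in> A"
    unfolding odd_leader_iff
  proof (intro conjI allI)
    show "odd l" using coset_odd[OF l] assms by simp
    show "l < N" by (rule lN)
    fix s
    have "(l * q ^ s) mod N \<in> C i"
      by (rule coset_trans[OF _ l]) (auto simp: cyc_coset_def)
    then show "l \<le> (l * q ^ s) mod N" unfolding l_def using finite_coset by simp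
  qed
  moreover have "i \<in> C l" using coset_sym[OF l assms(2)] .
  ultimately show ?thesis using l by blast
qed

text \<open>Coprimality of \<open>q\<close> and \<open>N\<close> keeps \<open>J * q ^ s\<close>
  nonzero modulo \<open>N\<close>, so complementing commutes with rotation and exchanges minima and
  maxima; parity is kept because \<open>N\<close> is even.\<close>

lemma leader_complements_iff:
  assumes "0 < J" "J < N"
  shows "J \<in> leader_complements \<longleftrightarrow> N - J \<in> A"
proof -
  have *: "((N - J) * q ^ s) mod N = N - (J * q ^ s) mod N" for s
  proof -
    have "(J * q ^ s) mod N \<noteq> 0"
    proof
      assume "(J * q ^ s) mod N = 0"
      then have "N dvd J * q ^ s" by (rule mod_0_imp_dvd)
      moreover have "coprime N (q ^ s)" using coprime_q_N[of s] coprime_commute by blast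
      ultimately have "N dvd J" by (simp only: coprime_dvd_mult_left_iff)
      then show False using assms by (auto dest: dvd_imp_le)
    qed
    moreover have "((N - J) * q ^ s + J * q ^ s) mod N = 0"
      using assms by (simp flip: distrib_right)
    then have "(((N - J) * q ^ s) mod N + (J * q ^ s) mod N) mod N = 0"
      by (simp only: mod_add_eq)
    then have "N dvd ((N - J) * q ^ s) mod N + (J * q ^ s) mod N" by (rule mod_0_imp_dvd)
    then obtain c where "((N - J) * q ^ s) mod N + (J * q ^ s) mod N = N * c" by (elim dvdE)
    moreover have "((N - J) * q ^ s) mod N < N" "(J * q ^ s) mod N < N" using N_pos by simp_all
    ultimately have "N * c < N * 2" "0 < N * c" by linarith+
    then have "c = 1" using N_pos by simp
    then show ?thesis using \<open>_ = N * c\<close> by simp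
  qed
  have "N - J \<le> N - (J * q ^ s) mod N \<longleftrightarrow> (J * q ^ s) mod N \<le> J" for s
    using assms mod_less_divisor[OF N_pos, of "J * q ^ s"] by linarith
  moreover have "odd (N - J) \<longleftrightarrow> odd J" using even_N assms by simp
  ultimately show ?thesis using assms unfolding leader_complements_def odd_leader_iff * by auto
qed

text \<open>\<open>d\<close> is the least positive period of \<open>i\<close> under multiplication
  by \<open>q\<close>. Periods are expressed by divisibility so that they pass easily from
  \<open>i\<close> to its complement.\<close>

lemma card_coset:
  assumes "i < N"
  obtains d where "d dvd m" "0 < d" "card (C i) = d" "\<And>j. N dvd i * (q ^ j - 1) \<longleftrightarrow> d dvd j"
proof -
  have per: "N dvd i * (q ^ j - 1) \<longleftrightarrow> [i * q ^ j = i] (mod N)" for j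
  proof -
    have "i \<le> i * q ^ j" by simp
    then show ?thesis by (simp only: cong_altdef_nat diff_mult_distrib2 mult_1_right)
  qed
  define d where "d = (LEAST j. 0 < j \<and> [i * q ^ j = i] (mod N))"
  have ex: "0 < m \<and> [i * q ^ m = i] (mod N)" using m_ge cong_power_m by simp
  have d: "0 < d" "[i * q ^ d = i] (mod N)"
    using LeastI[of "\<lambda>j. 0 < j \<and> [i * q ^ j = i] (mod N)", OF ex] by (auto simp: d_def)
  have least: "d \<le> j" if "0 < j" "[i * q ^ j = i] (mod N)" for j
    unfolding d_def using that by (intro Least_le) simp
  have mult: "[i * q ^ (d * k) = i] (mod N)" for k
  proof (induction k)
    case (Suc k)
    have "[i * q ^ (d * k) * q ^ d = i * q ^ d] (mod N)" using Suc by (rule cong_scalar_right)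
    then have "[i * q ^ (d * k) * q ^ d = i] (mod N)" using d(2) by (rule cong_trans)
    then show ?case by (simp add: power_add mult_ac)
  qed simp
  have red: "[i * q ^ j = i * q ^ (j mod d)] (mod N)" for j
  proof -
    have "[i * q ^ (d * (j div d)) * q ^ (j mod d) = i * q ^ (j mod d)] (mod N)"
      using mult by (rule cong_scalar_right)
    then show ?thesis by (simp add: mult.assoc flip: power_add)
  qed
  have dvd: "[i * q ^ j = i] (mod N) \<longleftrightarrow> d dvd j" for j
  proof
    assume "[i * q ^ j = i] (mod N)"
    then have "[i * q ^ (j mod d) = i] (mod N)" using red[of j] cong_sym cong_trans by blast
    then have "\<not> 0 < j mod d" using least d(1) mod_less_divisor[OF d(1), of j] by (meson not_le)
    then show "d dvd j" by (simp add: dvd_eq_mod_eq_0)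
  next
    assume "d dvd j"
    then show "[i * q ^ j = i] (mod N)" using mult by (elim dvdE) simp
  qed
  have "C i = (\<lambda>j. (i * q ^ j) mod N) ` {..<d}"
  proof
    show "C i \<subseteq> (\<lambda>j. (i * q ^ j) mod N) ` {..<d}"
    proof
      fix x assume "x \<in> C i"
      then obtain j where "x = (i * q ^ j) mod N" by (auto simp: cyc_coset_def)
      then have "x = (i * q ^ (j mod d)) mod N" using red[of j] by (simp add: cong_def)
      then show "x \<in> (\<lambda>j. (i * q ^ j) mod N) ` {..<d}" using d(1) by simp
    qed
  qed (auto simp: cyc_coset_def)
  moreover have "inj_on (\<lambda>j. (i * q ^ j) mod N) {..<d}"
  proof (rule linorder_inj_onI)
    fix a b :: nat assume ab: "a < b" "a \<in> {..<d}" "b \<in> {..<d}"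
    show "(i * q ^ a) mod N \<noteq> (i * q ^ b) mod N"
    proof
      assume "(i * q ^ a) mod N = (i * q ^ b) mod N"
      moreover have "i * q ^ b = (i * q ^ (b - a)) * q ^ a"
        using ab by (simp add: mult.assoc flip: power_add)
      ultimately have "[i * q ^ a = (i * q ^ (b - a)) * q ^ a] (mod N)" by (simp add: cong_def)
      then have "[i = i * q ^ (b - a)] (mod N)"
        using cong_mult_rcancel_nat[OF coprime_q_N] by blast
      then have "d \<le> b - a" using ab by (intro least) (auto simp: cong_sym_eq)
      then show False using ab by auto
    qed
  qed auto
  ultimately have "card (C i) = d" by (simp add: card_image)
  then show ?thesis using that[of d] d(1) dvd per ex by blast
qed

text \<open>The last alternative is impossible for the complements of \<open>\<delta> 1\<close>,
  \<open>\<delta> 2\<close>, \<open>\<delta> 3\<close>, so for them only the two sizes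
  remain.\<close>

lemma card_coset_complement:
  assumes "J \<in> leader_complements"
  shows "card (C (N - J)) = m
     \<or> (m mod 3 = 0 \<and> J = three_ones (m div 3) (m div 3) (m div 3) \<and> card (C (N - J)) = m div 3)
     \<or> 3 \<le> card {J' \<in> leader_complements. J' < J}"
proof -
  have J: "0 < J" "J < N" using assms by (auto simp: leader_complements_def odd_pos)
  then have "N - J < N" by simp
  then obtain d where d: "d dvd m" "0 < d" "card (C (N - J)) = d"
      "\<And>j. N dvd (N - J) * (q ^ j - 1) \<longleftrightarrow> d dvd j"
    by (rule card_coset) blast
  show ?thesis
  proof (cases "d = m")
    case False
    have "N dvd (N - J) * (q ^ d - 1)" using d by simp
    then have "N dvd N * (q ^ d - 1) - (N - J) * (q ^ d - 1)" by (intro dvd_diff_nat) auto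
    moreover have "N * (q ^ d - 1) - (N - J) * (q ^ d - 1) = J * (q ^ d - 1)"
      using J by (simp flip: diff_mult_distrib)
    ultimately have "N dvd J * (q ^ d - 1)" by simp
    moreover have "d < m" using dvd_imp_le[OF d(1)] False m_ge by simp
    ultimately show ?thesis using periodic_cases[OF assms d(1,2)] d(3) by auto
  qed (use d in simp)
qed

lemma card_coset_diagonal:
  assumes "m = 3 * k"
  shows "three_ones k k k \<in> leader_complements" "card (C (N - three_ones k k k)) = k" "{J \<in> leader_complements. J < three_ones k k k} = {q ^ (m - 1)}"
proof -
  have k: "k > 0" using assms m_ge by simp
  show TS: "three_ones k k k \<in> leader_complements" by (rule three_ones_in_leader_complements) (use assms k in auto)
  have "m - 1 = k + k + k - 1" using assms by simp
  then have "q ^ (m - 1) < three_ones k k k" using q_pos by (simp add: three_ones_def)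
  then show eq: "{J \<in> leader_complements. J < three_ones k k k} = {q ^ (m - 1)}"
    using below_three_ones_diagonal[OF _ _ assms] q_power_in_leader_complements by blast
  let ?J = "three_ones k k k"
  have J: "0 < ?J" "?J < N" using TS by (auto simp: leader_complements_def odd_pos)
  have "N - ?J < N" using J by simp
  then obtain d where d: "d dvd m" "0 < d" "card (C (N - ?J)) = d"
      "\<And>j. N dvd (N - ?J) * (q ^ j - 1) \<longleftrightarrow> d dvd j"
    by (rule card_coset) blast
  have "?J * (q ^ k - 1) = q ^ (k - 1) * ((q ^ k - 1) * (\<Sum>l<3. q ^ (k * l)))"
    unfolding three_ones_eq[OF k] by (simp add: numeral_3_eq_3 mult_2_right algebra_simps)
  also have "\<dots> = q ^ (k - 1) * N"
    using geometric_sum_nat[OF q_pos] assms N_def by (metis mult.commute)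
  finally have "N dvd ?J * (q ^ k - 1)" by simp
  then have "N dvd N * (q ^ k - 1) - ?J * (q ^ k - 1)" by (intro dvd_diff_nat) auto
  then have "N dvd (N - ?J) * (q ^ k - 1)" by (simp only: diff_mult_distrib)
  \<comment> \<open>The computation shows only that the size divides \<open>k\<close>. Equality
    follows from the preceding trichotomy, since a single string lies below the diagonal
    one.\<close>
  then have dk: "d dvd k" using d(4) by simp
  have "d \<le> k" using dk k by (rule dvd_imp_le)
  then have "d \<noteq> m" using assms k by simp
  then show "card (C (N - ?J)) = k"
    using card_coset_complement[OF TS] d(3) assms eq by auto
qed

section \<open>The three largest odd leaders\<close>

abbreviation \<delta> :: "nat \<Rightarrow> nat" where "\<delta> \<equiv> odd_leader_delta q N"

lemma card_greater_odd_leaders: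
  assumes "i < N" "0 < i"
  shows "card {l \<in> A. i < l} = card {J \<in> leader_complements. J < N - i}"
proof -
  have "bij_betw (\<lambda>l. N - l) {l \<in> A. i < l} {J \<in> leader_complements. J < N - i}"
  proof (rule bij_betwI[where g = "\<lambda>J. N - J"])
    show "(\<lambda>l. N - l) \<in> {l \<in> A. i < l} \<rightarrow> {J \<in> leader_complements. J < N - i}"
    proof
      fix l assume l: "l \<in> {l \<in> A. i < l}"
      then have "l < N" "0 < l" by (auto simp: odd_leader_iff)
      then show "N - l \<in> {J \<in> leader_complements. J < N - i}" using l leader_complements_iff[of "N - l"] by auto
    qed
    show "(\<lambda>J. N - J) \<in> {J \<in> leader_complements. J < N - i} \<rightarrow> {l \<in> A. i < l}"
    proof
      fix J assume J: "J \<in> {J \<in> leader_complements. J < N - i}"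
      then have "J < N" "0 < J" by (auto simp: leader_complements_def odd_pos)
      then show "N - J \<in> {l \<in> A. i < l}" using J leader_complements_iff[of J] by auto
    qed
  qed (auto simp: odd_leader_iff leader_complements_def)
  then show ?thesis by (rule bij_betw_same_card)
qed

lemma \<delta>_props:
  assumes "0 < k" "k \<le> card A"
  shows "\<delta> k \<in> A" "card {l \<in> A. \<delta> k < l} = k - 1" "N - \<delta> k \<in> leader_complements"
    "card {J \<in> leader_complements. J < N - \<delta> k} = k - 1"
proof -
  show a: "\<delta> k \<in> A" and c: "card {l \<in> A. \<delta> k < l} = k - 1"
    unfolding odd_leader_delta_def using nth_rev_sorted_list_of_set[OF finite_odd_leaders assms] by auto
  have "\<delta> k < N" "0 < \<delta> k" using a by (auto simp: odd_leader_iff odd_pos)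
  then show "N - \<delta> k \<in> leader_complements" "card {J \<in> leader_complements. J < N - \<delta> k} = k - 1"
    using leader_complements_iff[of "N - \<delta> k"] card_greater_odd_leaders[of "\<delta> k"] a c by auto
qed

lemma \<delta>_strict:
  assumes "0 < j" "j < k" "k \<le> card A"
  shows "\<delta> k < \<delta> j"
proof (rule ccontr)
  assume "\<not> \<delta> k < \<delta> j"
  then have "card {l \<in> A. \<delta> k < l} \<le> card {l \<in> A. \<delta> j < l}"
    using finite_odd_leaders by (intro card_mono) auto
  then show False using \<delta>_props(2)[of j] \<delta>_props(2)[of k] assms by simp
qed

lemma greater_\<delta>:
  assumes "0 < k" "k \<le> card A"
  shows "{l \<in> A. \<delta> k < l} = \<delta> ` {1..<k}"
proof (rule sym, rule card_subset_eq)
  show "finite {l \<in> A. \<delta> k < l}" using finite_odd_leaders by simp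
  show "\<delta> ` {1..<k} \<subseteq> {l \<in> A. \<delta> k < l}"
    using \<delta>_props(1) \<delta>_strict assms by auto
  have "inj_on \<delta> {1..<k}"
  proof (rule linorder_inj_onI)
    fix i j assume "i < j" "i \<in> {1..<k}" "j \<in> {1..<k}"
    then show "\<delta> i \<noteq> \<delta> j" using \<delta>_strict[of i j] assms(2) by simp
  qed auto
  then show "card (\<delta> ` {1..<k}) = card {l \<in> A. \<delta> k < l}"
    using \<delta>_props(2)[OF assms] by (simp add: card_image)
qed

text \<open>These counts ensure that the list accesses behind \<open>\<delta> 2\<close> and
  \<open>\<delta> 3\<close> are in range.\<close>

lemma card_odd_leaders: "2 \<le> card A" "25 \<le> q ^ m \<Longrightarrow> 3 \<le> card A"
proof -
  have top: "3 * q ^ (m - 1) \<le> q ^ m" by (rule q_power_lt) (use m_ge in simp)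
  have q1: "3 \<le> q ^ (m - 1)" by (rule q_power_ge) (use m_ge in simp)
  have a: "N - q ^ (m - 1) \<in> A" "N - (2 * q ^ (m - 1) + 1) \<in> A"
    using leader_complements_iff[of "q ^ (m - 1)"] leader_complements_iff[of "2 * q ^ (m - 1) + 1"] q_power_in_leader_complements two_top_in_leader_complements
    by (auto simp: leader_complements_def)
  have "card {N - q ^ (m - 1), N - (2 * q ^ (m - 1) + 1)} \<le> card A"
    by (rule card_mono[OF finite_odd_leaders]) (use a in auto)
  moreover have "N - q ^ (m - 1) \<noteq> N - (2 * q ^ (m - 1) + 1)" using top q1 Suc_N by linarith
  ultimately show "2 \<le> card A" by simp
  assume "25 \<le> q ^ m"
  then have "3 \<le> card {J \<in> leader_complements. J < N - 1}" by (rule card_leader_complements_ge)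
  also have "\<dots> = card {l \<in> A. 1 < l}" using card_greater_odd_leaders[of 1] N_ge by simp
  also have "\<dots> \<le> card A" by (rule card_mono) (use finite_odd_leaders in auto)
  finally show "3 \<le> card A" .
qed

lemma \<delta>1: "\<delta> 1 = N - q ^ (m - 1)" "card (C (\<delta> 1)) = m"
proof -
  have c: "1 \<le> card A" using card_odd_leaders(1) by simp
  note p = \<delta>_props[OF zero_less_one c]
  have lt: "\<delta> 1 < N" using p(1) by (auto simp: odd_leader_iff)
  have e: "{J \<in> leader_complements. J < N - \<delta> 1} = {}" using p(4) finite_leader_complements by simp
  then have "\<not> q ^ (m - 1) < N - \<delta> 1" using q_power_in_leader_complements by blast
  then have eq: "N - \<delta> 1 = q ^ (m - 1)" using leader_complements_ge[of "N - \<delta> 1"] p(3) by simp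
  then show "\<delta> 1 = N - q ^ (m - 1)" using lt by simp
  have "q ^ (m - 1) \<noteq> three_ones (m div 3) (m div 3) (m div 3)" if "m mod 3 = 0"
    using card_coset_diagonal(3)[of "m div 3"] that by auto
  then show "card (C (\<delta> 1)) = m"
    using card_coset_complement[OF p(3)] lt p(4) unfolding eq[symmetric] by (auto simp del: One_nat_def)
qed

text \<open>If 3 divides \<open>m\<close>, exactly one string lies below the diagonal one, so by
  rank the diagonal string is the complement of \<open>\<delta> 2\<close>.\<close>

lemma \<delta>2: "card (C (\<delta> 2)) = (if m mod 3 = 0 then m div 3 else m)"
proof -
  have c: "2 \<le> card A" by (rule card_odd_leaders)
  note p = \<delta>_props[OF _ c, simplified]
  have lt: "\<delta> 2 < N" using p(1) by (auto simp: odd_leader_iff)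
  show ?thesis
  proof (cases "m mod 3 = 0")
    case False
    then show ?thesis using card_coset_complement[of "N - \<delta> 2"] p(3,4) lt by auto
  next
    case True
    let ?T = "three_ones (m div 3) (m div 3) (m div 3)"
    note t = card_coset_diagonal[of "m div 3"]
    have "N - \<delta> 2 = ?T"
    proof (rule ccontr)
      assume "N - \<delta> 2 \<noteq> ?T"
      then consider "N - \<delta> 2 < ?T" | "?T < N - \<delta> 2" by linarith
      then show False
      proof cases
        case 1
        then have "N - \<delta> 2 = q ^ (m - 1)" using t(3) p(3) True by auto
        then have "\<delta> 2 = \<delta> 1" using \<delta>1 lt by simp
        then show False using \<delta>_strict[of 1 2] c by simp
      next
        case 2
        moreover have "q ^ (m - 1) \<in> {J \<in> leader_complements. J < ?T}" "?T \<in> leader_complements" using t True by auto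
        ultimately have "{q ^ (m - 1), ?T} \<subseteq> {J \<in> leader_complements. J < N - \<delta> 2}" by auto
        then have "card {q ^ (m - 1), ?T} \<le> 1"
          using p(4) card_mono[of "{J \<in> leader_complements. J < N - \<delta> 2}"] finite_leader_complements by fastforce
        then show False using t(3) True by (auto simp: card_insert_if split: if_splits)
      qed
    qed
    then have "\<delta> 2 = N - ?T" using lt by simp
    then show ?thesis using t(2) True by auto
  qed
qed

text \<open>Two strings lie below the complement of \<open>\<delta> 3\<close> but one below the
  diagonal string, so they differ. Likewise at least three leaders exceed 1 but only two exceed
  \<open>\<delta> 3\<close>.\<close>

lemma \<delta>3:
  assumes "25 \<le> q ^ m"
  shows "card (C (\<delta> 3)) = m" "3 \<le> \<delta> 3"
proof -
  have c: "3 \<le> card A" using assms by (rule card_odd_leaders)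
  note p = \<delta>_props[OF _ c, simplified]
  have lt: "\<delta> 3 < N" "odd (\<delta> 3)" using p(1) by (auto simp: odd_leader_iff)
  have "N - \<delta> 3 \<noteq> three_ones (m div 3) (m div 3) (m div 3)" if "m mod 3 = 0"
    using card_coset_diagonal(3)[of "m div 3"] that p(4) by auto
  then show "card (C (\<delta> 3)) = m"
    using card_coset_complement[of "N - \<delta> 3"] p(3,4) lt by auto
  have "\<delta> 3 \<noteq> 1"
    using card_leader_complements_ge[OF assms] p(4) by auto
  then show "3 \<le> \<delta> 3" using lt(2) by presburger
qed

text \<open>Here \<open>q = 3\<close> and \<open>m = 2\<close>, and \<open>\<delta> 3\<close> is an
  access beyond the list. The bound empties the second range of \<open>\<delta>'\<close> whatever
  value that access has.\<close>

lemma \<delta>2_small: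
  assumes "q ^ m < 25"
  shows "\<delta> 2 < 3"
proof (rule ccontr)
  assume *: "\<not> \<delta> 2 < 3"
  have top: "3 * q ^ (m - 1) \<le> q ^ m" by (rule q_power_lt) (use m_ge in simp)
  have "m = 2"
  proof (rule ccontr)
    assume "m \<noteq> 2"
    then have "3 * q ^ 2 \<le> q ^ m" using m_ge by (intro q_power_lt) simp
    moreover have "3 ^ 2 \<le> q ^ 2" using q_ge by (intro power_mono) auto
    ultimately show False using assms by simp
  qed
  moreover have "q < 5"
  proof (rule ccontr)
    assume "\<not> q < 5"
    then have "5 ^ 2 \<le> q ^ 2" by (intro power_mono) auto
    then show False using assms \<open>m = 2\<close> by simp
  qed
  ultimately have q3: "q = 3" "m = 2" using q_ge q_odd by presburger+
  then have N: "N = 8" using N_def by simp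
  have "\<delta> 2 < \<delta> 1" using \<delta>_strict[of 1 2] card_odd_leaders by simp
  also have "\<delta> 1 = 5" using \<delta>1 N q3 by simp
  finally have "\<delta> 2 = 3 \<or> \<delta> 2 = 4" using * by auto
  moreover have "odd (\<delta> 2)" "\<delta> 2 \<le> (\<delta> 2 * q ^ 1) mod N"
    using \<delta>_props(1)[OF pos2 card_odd_leaders(1)] unfolding odd_leader_iff by blast+
  ultimately show False using N q3 by auto
qed

lemma uncovered_exponents:
  assumes "odd r"
  shows "{i. odd i \<and> i < N \<and> (\<forall>s. odd s \<and> s \<le> r \<longrightarrow> i \<notin> C s)} = (\<Union>l\<in>{l \<in> A. r < l}. C l)"
    (is "?L = ?R")
proof
  show "?L \<subseteq> ?R"
  proof
    fix i assume i: "i \<in> ?L"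
    then obtain l where l: "l \<in> A" "i \<in> C l" using ex_leader[of i] by auto
    then have "r < l" using i by (force simp: odd_leader_iff)
    then show "i \<in> ?R" using l by auto
  qed
  show "?R \<subseteq> ?L"
  proof
    fix i assume "i \<in> ?R"
    then obtain l where l: "l \<in> A" "r < l" "i \<in> C l" by auto
    have "i \<notin> C s" if "s \<le> r" for s
    proof
      assume "i \<in> C s"
      have "s < N" using that l by (auto simp: odd_leader_iff)
      then have "s \<in> C l" using coset_sym[OF \<open>i \<in> C s\<close>] coset_trans l(3) by blast
      then show False using odd_leader_le[OF l(1)] that l(2) by fastforce
    qed
    moreover have "odd i" using coset_odd[OF l(3)] l(1) by (simp add: odd_leader_iff)
    moreover have "i < N" using l(3) coset_subset by blast
    ultimately show "i \<in> ?L" by blast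
  qed
qed

lemma card_UN_cosets:
  assumes "L \<subseteq> A"
  shows "card (\<Union>l\<in>L. C l) = (\<Sum>l\<in>L. card (C l))"
proof (rule card_UN_disjoint)
  show "finite L" using assms finite_odd_leaders finite_subset by blast
  show "\<forall>l\<in>L. finite (C l)" using finite_coset by simp
  show "\<forall>l\<in>L. \<forall>l'\<in>L. l \<noteq> l' \<longrightarrow> C l \<inter> C l' = {}"
  proof (intro ballI impI equals0I)
    fix l l' i assume *: "l \<in> L" "l' \<in> L" "l \<noteq> l'" "i \<in> C l \<inter> C l'"
    then have A: "l \<in> A" "l' \<in> A" using assms by auto
    then have "l < N" "l' < N" by (auto simp: odd_leader_iff)
    then have "l \<in> C l'" "l' \<in> C l" using * coset_sym coset_trans by blast+
    then have "l' \<le> l" "l \<le> l'" using A odd_leader_le by blast+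
    then show False using * by simp
  qed
qed

end

section \<open>Polynomials and linear codes over finite fields\<close>

lemma finite_field_power_card:
  fixes x :: "'a :: {field, finite}"
  shows "x ^ card (UNIV :: 'a set) = x"
proof (cases "x = 0")
  case True
  then show ?thesis using finite_UNIV_card_ge_0[where ?'a = 'a] by (simp add: power_0_left)
next
  case False
  have "(\<Prod>y\<in>UNIV - {0}. x * y) = (\<Prod>y\<in>UNIV - {0}. y)"
    by (rule prod.reindex_bij_witness[of _ "\<lambda>y. y / x" "\<lambda>y. x * y"]) (use False in auto)
  then have "x ^ (card (UNIV :: 'a set) - 1) * \<Prod>(UNIV - {0 :: 'a}) = \<Prod>(UNIV - {0})"
    by (simp add: prod.distrib)
  moreover have "\<Prod>(UNIV - {0 :: 'a}) \<noteq> 0" by simp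
  ultimately have "x ^ (card (UNIV :: 'a set) - 1) = 1" by simp
  then have "x ^ Suc (card (UNIV :: 'a set) - 1) = x" by simp
  then show ?thesis using finite_UNIV_card_ge_0[where ?'a = 'a] by simp
qed

section \<open>Field embeddings and minimal polynomials\<close>

context
  fixes f :: "'a :: field \<Rightarrow> 'b :: field"
  assumes f: "field_emb f"
begin

lemma emb_inj: "inj f" and emb_0 [simp]: "f 0 = 0" and emb_1 [simp]: "f 1 = 1"
  and emb_add: "f (x + y) = f x + f y" and emb_mult: "f (x * y) = f x * f y"
  using f by (auto simp: field_emb_def)

lemma emb_uminus: "f (- x) = - f x"
  using emb_add[of x "- x"] by (simp add: eq_neg_iff_add_eq_0 add.commute)

lemma emb_eq_0_iff: "f x = 0 \<longleftrightarrow> x = 0"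
  using emb_inj by (metis emb_0 injD)

lemma emb_power: "f (x ^ k) = f x ^ k"
  by (induction k) (simp_all add: emb_mult)

lemma emb_sum: "f (sum g X) = (\<Sum>x\<in>X. f (g x))"
  by (induction X rule: infinite_finite_induct) (simp_all add: emb_add)

lemma map_poly_emb_add: "map_poly f (p + r) = map_poly f p + map_poly f r"
  by (rule poly_eqI) (simp add: coeff_map_poly emb_add)

lemma map_poly_emb_mult: "map_poly f (p * r) = map_poly f p * map_poly f r"
  by (rule poly_eqI) (simp add: coeff_map_poly coeff_mult emb_sum emb_mult)

lemma map_poly_emb_prod: "map_poly f (prod g X) = (\<Prod>x\<in>X. map_poly f (g x))"
  by (induction X rule: infinite_finite_induct) (simp_all add: map_poly_emb_mult)

lemma degree_map_poly_emb: "degree (map_poly f p) = degree p"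
  by (rule degree_map_poly) (simp add: emb_eq_0_iff)

lemma map_poly_emb_eq_0_iff: "map_poly f p = 0 \<longleftrightarrow> p = 0"
  by (rule map_poly_eq_0_iff) (simp_all add: emb_eq_0_iff)

lemma emb_poly: "f (poly p x) = poly (map_poly f p) (f x)"
  by (induction p) (simp_all add: map_poly_pCons emb_add emb_mult)

text \<open>\<open>r0\<close> witnesses that \<open>b\<close> is algebraic, so a monic annihilator
  of least degree exists. It is unique because the difference of two has smaller degree, hence the
  description in \<open>min_poly\<close> denotes it; division with remainder does the rest.\<close>

lemma min_poly_dvd_iff:
  assumes "r0 \<noteq> 0" "poly (map_poly f r0) b = 0"
  shows "min_poly f b dvd r \<longleftrightarrow> poly (map_poly f r) b = 0"
proof -
  define root where "root p \<longleftrightarrow> p \<noteq> 0 \<and> poly (map_poly f p) b = 0" for p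
  define P where "P p \<longleftrightarrow> p \<noteq> 0 \<and> lead_coeff p = 1 \<and> poly (map_poly f p) b = 0 \<and>
      (\<forall>r. r \<noteq> 0 \<and> poly (map_poly f r) b = 0 \<longrightarrow> degree p \<le> degree r)" for p
  have smult: "poly (map_poly f (Polynomial.smult c p)) b = f c * poly (map_poly f p) b" for c p
    using map_poly_emb_mult[of "[:c:]" p] by (simp add: map_poly_pCons)
  have "root r0" using assms by (simp add: root_def)
  then obtain p0 where p0: "root p0" "\<And>r. root r \<Longrightarrow> degree p0 \<le> degree r"
    using ex_has_least_nat[of root r0 degree] by blast
  define p where "p = Polynomial.smult (inverse (lead_coeff p0)) p0"
  have "p0 \<noteq> 0" using p0 by (simp add: root_def)
  then have Pp: "P p"
    using p0 unfolding P_def p_def root_def smult by (auto simp: smult)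
  have "p' = p" if "P p'" for p'
  proof (rule ccontr)
    assume neq: "p' \<noteq> p"
    have deg: "degree p' = degree p" using Pp that unfolding P_def by (meson le_antisym)
    define r where "r = p' + Polynomial.smult (-1) p"
    have "poly (map_poly f r) b = 0"
      using Pp that unfolding P_def r_def map_poly_emb_add poly_add smult by simp
    moreover have "r \<noteq> 0" using neq by (simp add: r_def)
    ultimately have "degree p \<le> degree r" using Pp unfolding P_def by blast
    moreover have "Polynomial.coeff r (degree p) = 0" using Pp that deg unfolding P_def r_def by simp
    moreover have "degree r \<le> degree p" unfolding r_def by (rule degree_add_le) (use deg in auto)
    ultimately have "lead_coeff r = 0" by simp
    then show False using \<open>r \<noteq> 0\<close> by simp
  qed
  then have "(THE p. P p) = p" using Pp by (intro the_equality)
  then have mp: "min_poly f b = p" unfolding min_poly_def P_def .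
  have root_p: "poly (map_poly f p) b = 0" and pn: "p \<noteq> 0" using Pp by (auto simp: P_def)
  show ?thesis unfolding mp
  proof
    assume "p dvd r"
    then show "poly (map_poly f r) b = 0" using root_p by (auto elim!: dvdE simp: map_poly_emb_mult)
  next
    assume r: "poly (map_poly f r) b = 0"
    have "poly (map_poly f (p * (r div p) + r mod p)) b = 0" using r by simp
    then have m: "poly (map_poly f (r mod p)) b = 0"
      unfolding map_poly_emb_add map_poly_emb_mult using root_p by simp
    have "r mod p = 0"
    proof (rule ccontr)
      assume nz: "r mod p \<noteq> 0"
      then have "degree p \<le> degree (r mod p)" using Pp m unfolding P_def by blast
      then show False using degree_mod_less'[OF pn nz] by simp
    qed
    then show "p dvd r" by (simp add: dvd_eq_mod_eq_0)
  qed
qed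

end

section \<open>Codes of multiples of a polynomial, and distance bounds\<close>

definition polys_below :: "nat \<Rightarrow> 'a :: zero poly set" where
  "polys_below k = {p. \<forall>i\<ge>k. Polynomial.coeff p i = 0}"

lemma polys_below_iff: "p \<in> polys_below k \<longleftrightarrow> p = 0 \<or> degree p < k"
  unfolding polys_below_def using leading_coeff_0_iff[of p] coeff_eq_0[of p]
  by (auto simp: not_less intro: leI)

lemma card_polys_below:
  "finite (polys_below k :: 'a :: {zero, finite} poly set) \<and>
   card (polys_below k :: 'a poly set) = card (UNIV :: 'a set) ^ k"
proof (induction k)
  case 0
  have "polys_below 0 = {0 :: 'a poly}" by (auto simp: polys_below_iff)
  then show ?case by simp
next
  case (Suc k)
  have "polys_below (Suc k) = (\<lambda>(x, p). pCons x p) ` (UNIV \<times> (polys_below k :: 'a poly set))"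
  proof (intro equalityI subsetI)
    fix p :: "'a poly" assume p: "p \<in> polys_below (Suc k)"
    obtain x p' where xp: "p = pCons x p'" by (cases p)
    have "Polynomial.coeff p' i = 0" if "i \<ge> k" for i
      using p that unfolding polys_below_def xp by (auto dest!: spec[of _ "Suc i"])
    then show "p \<in> (\<lambda>(x, p). pCons x p) ` (UNIV \<times> polys_below k)"
      unfolding xp polys_below_def by auto
  qed (auto simp: polys_below_def coeff_pCons split: nat.splits)
  moreover have "inj_on (\<lambda>(x, p). pCons x p) (UNIV \<times> (polys_below k :: 'a poly set))"
    by (auto simp: inj_on_def)
  ultimately show ?case using Suc by (simp add: card_image card_cartesian_product)
qed

lemma multiples_below:
  fixes g :: "'a :: field poly"
  assumes "g \<noteq> 0" "degree g \<le> n"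
  shows "{c. g dvd c \<and> c \<in> polys_below n} = (\<lambda>a. g * a) ` polys_below (n - degree g)"
proof -
  have "g * a \<in> polys_below n \<longleftrightarrow> a \<in> polys_below (n - degree g)" for a
    using assms by (cases "a = 0") (auto simp: polys_below_iff degree_mult_eq)
  then show ?thesis by (auto elim!: dvdE)
qed

lemma card_multiples_below:
  fixes g :: "'a :: {field, finite} poly"
  assumes "g \<noteq> 0" "degree g \<le> n"
  shows "card {c. g dvd c \<and> c \<in> polys_below n} = card (UNIV :: 'a set) ^ (n - degree g)"
  unfolding multiples_below[OF assms] using card_polys_below[of "n - degree g"] assms(1)
  by (subst card_image) (auto simp: inj_on_def)

text \<open>The products of \<open>g\<close> with the monomials of degree below
  \<open>n - degree g\<close> form a basis.\<close>

lemma code_dim_multiples_below: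
  fixes g :: "'a :: field poly"
  assumes "g \<noteq> 0" "degree g \<le> n"
  shows "code_dim {c. g dvd c \<and> c \<in> polys_below n} = n - degree g"
proof -
  interpret vector_space "Polynomial.smult :: 'a \<Rightarrow> 'a poly \<Rightarrow> 'a poly"
    by standard (simp_all add: smult_add_right smult_add_left)
  define k where "k = n - degree g"
  define b where "b i = g * Polynomial.monom 1 i" for i
  have b_inj: "inj_on b {..<k}"
  proof (rule inj_onI)
    fix i j assume "b i = b j"
    then have "Polynomial.monom (1 :: 'a) i = Polynomial.monom 1 j" using assms(1) by (simp add: b_def)
    then show "i = j" by (metis degree_monom_eq one_neq_zero)
  qed
  have lin: "(\<Sum>i<k. Polynomial.smult (u i) (b i)) = g * (\<Sum>i<k. Polynomial.monom (u i) i)" for u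
    by (simp add: b_def sum_distrib_left smult_monom flip: mult_smult_right)
  have "dim ((\<lambda>a. g * a) ` polys_below k) = k"
  proof (rule dim_unique)
    show "b ` {..<k} \<subseteq> (\<lambda>a. g * a) ` polys_below k"
      by (auto simp: b_def polys_below_def)
    show "(\<lambda>a. g * a) ` polys_below k \<subseteq> span (b ` {..<k})"
    proof clarify
      fix a :: "'a poly" assume a: "a \<in> polys_below k"
      have "a = (\<Sum>i<k. Polynomial.monom (Polynomial.coeff a i) i)"
        by (rule poly_eqI) (use a in \<open>auto simp: coeff_sum polys_below_def not_less\<close>)
      then have "g * a = (\<Sum>i<k. Polynomial.smult (Polynomial.coeff a i) (b i))" using lin by simp
      also have "\<dots> \<in> span (b ` {..<k})" by (intro span_sum span_scale span_base) auto
      finally show "g * a \<in> span (b ` {..<k})" .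
    qed
    show "independent (b ` {..<k})"
    proof (rule independent_if_scalars_zero)
      fix u x assume u: "(\<Sum>x\<in>b ` {..<k}. Polynomial.smult (u x) x) = 0" and x: "x \<in> b ` {..<k}"
      have "g * (\<Sum>i<k. Polynomial.monom (u (b i)) i) = 0"
        using u lin[of "u \<circ> b"] by (simp add: sum.reindex[OF b_inj])
      then have z: "(\<Sum>i<k. Polynomial.monom (u (b i)) i) = 0" using assms(1) by simp
      obtain j where j: "j < k" "x = b j" using x by auto
      have "Polynomial.coeff (\<Sum>i<k. Polynomial.monom (u (b i)) i) j = u (b j)" using j by (simp add: coeff_sum)
      then show "u x = 0" using z j by simp
    qed simp
    show "card (b ` {..<k}) = k" using b_inj by (simp add: card_image)
  qed
  then show ?thesis unfolding code_dim_def multiples_below[OF assms] k_def .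
qed

lemma finite_support: "finite {i. Polynomial.coeff c i \<noteq> 0}"
  by (metis MOST_coeff_eq_0 eventually_cofinite)

text \<open>The total weight is bounded coordinatewise: a coordinate functional on a linear code vanishes
  on at least a \<open>1/q\<close> fraction of the code words.\<close>
lemma min_dist_average:
  fixes D :: "'a :: {field, finite} poly set"
  assumes D: "finite D" "\<And>c c'. c \<in> D \<Longrightarrow> c' \<in> D \<Longrightarrow> c - c' \<in> D" "D \<subseteq> polys_below n" "0 \<in> D" "D \<noteq> {0}"
  defines "Q \<equiv> card (UNIV :: 'a set)"
  shows "Q * (card D - 1) * min_dist D \<le> n * ((Q - 1) * card D)"
proof -
  have low: "min_dist D \<le> hamming_wt c" if "c \<in> D" "c \<noteq> 0" for c
    unfolding min_dist_def using D(1) that by (intro Min_le) auto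
  have coord: "Q * card {c \<in> D. Polynomial.coeff c i \<noteq> 0} \<le> (Q - 1) * card D" for i
  proof -
    let ?K = "{c \<in> D. Polynomial.coeff c i = 0}"
    \<comment> \<open>Subtracting a fixed word of the fibre maps it injectively into the kernel of
      the coordinate.\<close>
    have fib: "card {c \<in> D. Polynomial.coeff c i = x} \<le> card ?K" for x
    proof (cases "{c \<in> D. Polynomial.coeff c i = x} = {}")
      case True
      then show ?thesis by (simp only: card.empty)
    next
      case False
      then obtain c0 where c0: "c0 \<in> D" "Polynomial.coeff c0 i = x" by blast
      show ?thesis
        by (rule card_inj_on_le[of "\<lambda>c. c - c0"]) (use D c0 in \<open>auto simp: inj_on_def\<close>)
    qed
    have "card D = card (\<Union>x\<in>UNIV. {c \<in> D. Polynomial.coeff c i = x})" by (rule arg_cong[of _ _ card]) auto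
    also have "\<dots> = (\<Sum>x\<in>UNIV. card {c \<in> D. Polynomial.coeff c i = x})"
      by (rule card_UN_disjoint) (use D in auto)
    also have "\<dots> \<le> (\<Sum>x\<in>(UNIV :: 'a set). card ?K)" by (intro sum_mono fib)
    finally have K: "card D \<le> Q * card ?K" by (simp add: Q_def)
    have "card D = card ({c \<in> D. Polynomial.coeff c i \<noteq> 0} \<union> ?K)" by (rule arg_cong[of _ _ card]) auto
    also have "\<dots> = card {c \<in> D. Polynomial.coeff c i \<noteq> 0} + card ?K"
      by (rule card_Un_disjoint) (use D in auto)
    finally have "Q * card {c \<in> D. Polynomial.coeff c i \<noteq> 0} + Q * card ?K = Q * card D"
      by (simp flip: distrib_left)
    then show ?thesis using K by (simp add: diff_mult_distrib)
  qed
  have "(card D - 1) * min_dist D = (\<Sum>c\<in>D - {0}. min_dist D)" using D by simp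
  also have "\<dots> \<le> (\<Sum>c\<in>D - {0}. hamming_wt c)" by (rule sum_mono) (use low in auto)
  also have "\<dots> \<le> (\<Sum>c\<in>D. hamming_wt c)" by (rule sum_mono2) (use D in auto)
  also have "\<dots> = (\<Sum>c\<in>D. \<Sum>i<n. if Polynomial.coeff c i \<noteq> 0 then 1 else 0)"
  proof (rule sum.cong[OF refl])
    fix c assume "c \<in> D"
    then have "{i. Polynomial.coeff c i \<noteq> 0} = {i \<in> {..<n}. Polynomial.coeff c i \<noteq> 0}"
      using D(3) unfolding polys_below_def by (auto simp flip: not_le)
    then show "hamming_wt c = (\<Sum>i<n. if Polynomial.coeff c i \<noteq> 0 then 1 else 0)"
      unfolding hamming_wt_def by (simp add: sum.If_cases Int_def)
  qed
  also have "\<dots> = (\<Sum>i<n. card {c \<in> D. Polynomial.coeff c i \<noteq> 0})"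
    by (subst sum.swap) (use D(1) in \<open>simp add: sum.If_cases Int_def\<close>)
  finally have "Q * ((card D - 1) * min_dist D) \<le> Q * (\<Sum>i<n. card {c \<in> D. Polynomial.coeff c i \<noteq> 0})"
    by (rule mult_left_mono) simp
  also have "\<dots> \<le> (\<Sum>i<n. (Q - 1) * card D)"
    unfolding sum_distrib_left by (rule sum_mono) (rule coord)
  finally show ?thesis by (simp add: mult.assoc)
qed

text \<open>Pairing a low-weight code word with the polynomial that vanishes at all but one of its
  support points replaces the usual Vandermonde determinant.\<close>
lemma bch_bound:
  fixes \<beta> :: "'b :: field" and e :: "'a :: field \<Rightarrow> 'b"
  assumes e: "field_emb e" and \<beta>: "\<beta> \<noteq> 0" "inj_on (\<lambda>i. (\<beta>\<^sup>2) ^ i) {..<n}"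
    and c: "c \<noteq> 0" "c \<in> polys_below n"
    and zeros: "\<And>s. s < r \<Longrightarrow> poly (map_poly e c) (\<beta> ^ (1 + 2 * s)) = 0"
  shows "r < hamming_wt c"
proof (rule ccontr)
  assume "\<not> r < hamming_wt c"
  define I where "I = {i. Polynomial.coeff c i \<noteq> 0}"
  have I: "finite I" "card I \<le> r" "I \<subseteq> {..<n}"
    using \<open>\<not> r < hamming_wt c\<close> finite_support c(2)
    by (auto simp: I_def hamming_wt_def polys_below_def not_less intro: leI)
  \<comment> \<open>The value of \<open>c\<close> at \<open>\<beta> ^ (1 + 2 * s)\<close> becomes
    the sum of \<open>w i * x i ^ s\<close>: the odd offset goes into the weights and the nodes are
    powers of the square of \<open>\<beta>\<close>.\<close>
  define w where "w i = e (Polynomial.coeff c i) * \<beta> ^ i" for i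
  define x where "x i = (\<beta>\<^sup>2) ^ i" for i
  have power: "(\<Sum>i\<in>I. w i * x i ^ s) = 0" if "s < r" for s
  proof -
    have "poly (map_poly e c) y = (\<Sum>i\<in>I. e (Polynomial.coeff c i) * y ^ i)" for y
    proof -
      have "poly (map_poly e c) y = (\<Sum>i\<le>degree c. e (Polynomial.coeff c i) * y ^ i)"
        using e by (simp add: poly_altdef degree_map_poly_emb coeff_map_poly emb_0)
      also have "\<dots> = (\<Sum>i\<in>I. e (Polynomial.coeff c i) * y ^ i)"
        by (rule sum.mono_neutral_right)
          (use e in \<open>auto simp: I_def emb_0 intro: le_degree\<close>)
      finally show ?thesis .
    qed
    then have "(\<Sum>i\<in>I. e (Polynomial.coeff c i) * (\<beta> ^ (1 + 2 * s)) ^ i) = 0" using zeros[OF that] by simp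
    moreover have "(\<beta> ^ (1 + 2 * s)) ^ i = \<beta> ^ i * x i ^ s" for i
      unfolding x_def by (simp add: power_add power_mult_distrib mult_ac flip: power_mult)
    ultimately show ?thesis by (simp add: w_def mult.assoc)
  qed
  have pairing: "(\<Sum>i\<in>I. w i * poly p (x i)) = 0" if "degree p < r" for p
  proof -
    have "(\<Sum>i\<in>I. w i * poly p (x i)) = (\<Sum>i\<in>I. \<Sum>s\<le>degree p. Polynomial.coeff p s * (w i * x i ^ s))"
      by (simp add: poly_altdef sum_distrib_left mult_ac)
    also have "\<dots> = (\<Sum>s\<le>degree p. Polynomial.coeff p s * (\<Sum>i\<in>I. w i * x i ^ s))"
      by (subst sum.swap) (simp add: sum_distrib_left)
    also have "\<dots> = 0" using power that by simp
    finally show ?thesis .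
  qed
  have "degree c \<in> I" using c(1) by (simp add: I_def)
  then obtain j where j: "j \<in> I" ..
  define p where "p = (\<Prod>i\<in>I - {j}. [:- x i, 1:])"
  have "degree p = card (I - {j})" unfolding p_def by (subst degree_prod_eq_sum_degree) auto
  also have "\<dots> < r" using I j by (metis card_Diff1_less le_trans not_le)
  finally have "(\<Sum>i\<in>I. w i * poly p (x i)) = 0" by (rule pairing)
  moreover have "(\<Sum>i\<in>I. w i * poly p (x i)) = (\<Sum>i\<in>{j}. w i * poly p (x i))"
    by (rule sum.mono_neutral_right) (use I j in \<open>auto simp: p_def poly_prod\<close>)
  ultimately have "w j = 0 \<or> poly p (x j) = 0" by simp
  moreover have "w j \<noteq> 0" using j \<beta> e by (simp add: w_def I_def emb_eq_0_iff)
  moreover have "poly p (x j) \<noteq> 0"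
    using I j \<beta>(2) by (auto simp: p_def poly_prod x_def inj_on_def)
  ultimately show False by simp
qed

section \<open>Parameters of the negacyclic BCH codes\<close>

text \<open>Identifies the extension degree \<open>ord (2 * n) q\<close> with \<open>m\<close>; a
  smaller order \<open>d\<close> would make \<open>q ^ m - 1\<close> divide the smaller positive
  number \<open>q ^ d - 1\<close>.\<close>

lemma ord_power_minus_one:
  fixes q m :: nat
  assumes "2 \<le> q" "0 < m"
  shows "ord (q ^ m - 1) q = m"
proof -
  have q1: "1 < q ^ m" using assms by (intro one_less_power) auto
  have "[q ^ m = 1] (mod q ^ m - 1)"
    using q1 by (simp add: cong_altdef_nat)
  then have dvd: "ord (q ^ m - 1) q dvd m" by (rule ord_divides[THEN iffD1])
  show ?thesis
  proof (rule ccontr)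
    assume neq: "ord (q ^ m - 1) q \<noteq> m"
    let ?d = "ord (q ^ m - 1) q"
    have d: "0 < ?d" "?d < m" using dvd_pos_nat[OF assms(2) dvd] neq dvd_imp_le[OF dvd assms(2)] by linarith+
    have "[q ^ ?d = 1] (mod q ^ m - 1)" by (rule ord)
    moreover have "1 < q ^ ?d" using d assms by (intro one_less_power) auto
    ultimately have "q ^ m - 1 dvd q ^ ?d - 1" by (simp add: cong_altdef_nat)
    moreover have "q ^ ?d < q ^ m" using d assms by (intro power_strict_increasing) auto
    ultimately show False using \<open>1 < q ^ ?d\<close> dvd_imp_le[of "q ^ m - 1" "q ^ ?d - 1"] by linarith
  qed
qed

text \<open>\<open>primitive_element\<close> only asserts surjectivity of the powers; counting
  yields injectivity. As \<open>0 ^ 0 = 1\<close>, zero satisfies the definition in the field of two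
  elements, whence the bound on the cardinality.\<close>

lemma primitive_element_powers:
  fixes \<alpha> :: "'b :: {field, finite}"
  assumes \<alpha>: "primitive_element \<alpha>" and card: "2 < card (UNIV :: 'b set)"
  defines "M \<equiv> card (UNIV :: 'b set) - 1"
  shows "\<alpha> \<noteq> 0" "\<alpha> ^ M = 1" "inj_on (\<lambda>i. \<alpha> ^ i) {..<M}"
proof -
  have M: "Suc M = card (UNIV :: 'b set)" "0 < M" using card by (auto simp: M_def)
  show nz: "\<alpha> \<noteq> 0"
  proof
    assume "\<alpha> = 0"
    then have "x = 0 \<or> x = 1" for x :: 'b
      using \<alpha> unfolding primitive_element_def by (metis power_0_left)
    then have "(UNIV :: 'b set) \<subseteq> {0, 1}" by auto
    then have "card (UNIV :: 'b set) \<le> card {0 :: 'b, 1}" by (intro card_mono) auto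
    then show False using card by simp
  qed
  have "\<alpha> * \<alpha> ^ M = \<alpha> * 1" using finite_field_power_card[of \<alpha>] by (simp flip: M(1))
  then show one: "\<alpha> ^ M = 1" using nz by simp
  have red: "\<alpha> ^ k = \<alpha> ^ (k mod M)" for k
  proof -
    have "\<alpha> ^ k = \<alpha> ^ (M * (k div M) + k mod M)" by simp
    then show ?thesis by (simp only: power_add power_mult one power_one mult_1_left)
  qed
  have "(\<lambda>i. \<alpha> ^ i) ` {..<M} = UNIV - {0}"
  proof (intro equalityI subsetI)
    fix x :: 'b assume "x \<in> UNIV - {0}"
    then obtain k where "x = \<alpha> ^ k" using \<alpha> by (auto simp: primitive_element_def)
    then have "x = \<alpha> ^ (k mod M)" using red by simp
    then show "x \<in> (\<lambda>i. \<alpha> ^ i) ` {..<M}" using M(2) by simp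
  qed (use nz in auto)
  then have "card ((\<lambda>i. \<alpha> ^ i) ` {..<M}) = card {..<M}" by (simp add: M_def)
  then show "inj_on (\<lambda>i. \<alpha> ^ i) {..<M}" by (intro eq_card_imp_inj_on) auto
qed

locale negacyclic_bch = odd_cyclotomy q m N for q m N :: nat +
  fixes e :: "'a :: {field_gcd, finite} \<Rightarrow> 'b :: {field, finite}" and \<beta> :: 'b and n :: nat
  assumes e: "field_emb e" and q_card: "card (UNIV :: 'a set) = q" and b_card: "card (UNIV :: 'b set) = q ^ m"
    and q_pp: "\<exists>p k. prime p \<and> 0 < k \<and> q = p ^ k"
    and N_2n: "N = 2 * n" and \<beta>_inj: "inj_on (\<lambda>i. \<beta> ^ i) {..<N}" and \<beta>_N: "\<beta> ^ N = 1"
begin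

lemma n_pos: "0 < n"
  using N_2n N_ge by simp

lemma \<beta>_nonzero: "\<beta> \<noteq> 0"
  using \<beta>_N N_pos by (auto simp: power_0_left)

lemma \<beta>_mod: "\<beta> ^ (i mod N) = \<beta> ^ i"
proof -
  have "\<beta> ^ i = \<beta> ^ (N * (i div N) + i mod N)" by simp
  also have "\<dots> = \<beta> ^ (i mod N)" by (simp only: power_add power_mult \<beta>_N power_one mult_1_left)
  finally show ?thesis by simp
qed

lemma \<beta>_n: "odd i \<Longrightarrow> (\<beta> ^ i) ^ n = - 1"
proof -
  assume i: "odd i"
  have "(\<beta> ^ n)\<^sup>2 = 1" using \<beta>_N N_2n by (simp add: mult.commute flip: power_mult)
  moreover have "\<beta> ^ n \<noteq> \<beta> ^ 0"
    using \<beta>_inj n_pos N_2n unfolding inj_on_def by (metis lessThan_iff less_add_same_cancel1 mult_2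
        add_pos_pos not_less_zero gr_implies_not0)
  ultimately have "\<beta> ^ n = - 1" by (simp add: power2_eq_1_iff)
  then have "(\<beta> ^ i) ^ n = (- 1) ^ i" by (metis mult.commute power_mult)
  then show ?thesis using i by simp
qed

section \<open>Frobenius and conjugate roots\<close>

lemma frobenius_add: "((x :: 'b) + y) ^ q = x ^ q + y ^ q"
proof -
  obtain p k where pk: "prime p" "0 < k" "q = p ^ k" using q_pp by blast
  have "prime CHAR('b)"
    by (rule prime_CHAR_semidom) (simp add: finite_imp_CHAR_pos)
  moreover have "CHAR('b) dvd q ^ m" using CHAR_dvd_CARD[where ?'a = 'b] b_card by simp
  ultimately have "CHAR('b) dvd p" unfolding pk(3) by (meson prime_dvd_power)
  then have "CHAR('b) = p" using pk(1) \<open>prime CHAR('b)\<close> by (simp add: primes_dvd_imp_eq)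
  then show ?thesis using \<open>prime CHAR('b)\<close> pk(3) by (intro freshmans_dream'[of q k]) auto
qed

text \<open>As a \<open>field_emb\<close>, Frobenius can reuse the \<open>map_poly\<close> facts
  proved for the embedding \<open>e\<close>.\<close>

lemma frobenius_emb: "field_emb (\<lambda>x :: 'b. x ^ q)"
proof -
  have "inj (\<lambda>x :: 'b. x ^ q)"
  proof (rule injI)
    fix x y :: 'b assume eq: "x ^ q = y ^ q"
    have "x ^ q = ((x - y) + y) ^ q" by simp
    also have "\<dots> = (x - y) ^ q + y ^ q" by (rule frobenius_add)
    finally have "(x - y) ^ q = 0" using eq by simp
    then show "x = y" by simp
  qed
  then show ?thesis
    using frobenius_add q_pos by (auto simp: field_emb_def power_mult_distrib power_0_left)
qed

lemma emb_power_q: "e x ^ q = e x"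
  using finite_field_power_card[of x] emb_power[OF e, of x q] q_card by simp

text \<open>The polynomial \<open>x ^ q - x\<close> has at most \<open>q\<close> roots, and the
  image of \<open>e\<close> already supplies \<open>q\<close> of them.\<close>

lemma fixed_by_frobenius: "x ^ q = x \<Longrightarrow> x \<in> range e"
proof -
  assume x: "x ^ q = x"
  define P :: "'b poly" where "P = Polynomial.monom 1 q + Polynomial.monom (- 1) 1"
  have P: "poly P y = y ^ q - y" for y by (simp add: P_def poly_monom)
  have "Polynomial.coeff P q = 1" using q_ge by (simp add: P_def)
  then have P0: "P \<noteq> 0" by auto
  have "degree P \<le> q"
    unfolding P_def by (intro degree_add_le) (use degree_monom_le[of "- 1 :: 'b" 1] q_ge in
        \<open>auto intro: degree_monom_le order_trans\<close>)
  then have le: "card {y. poly P y = 0} \<le> q"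
    using card_poly_roots_bound[OF P0] by simp
  have "range e = {y. poly P y = 0}"
  proof (rule card_seteq)
    show "finite {y. poly P y = 0}" by simp
    show "range e \<subseteq> {y. poly P y = 0}" using emb_power_q P by auto
    show "card {y. poly P y = 0} \<le> card (range e)"
      using le q_card by (simp add: card_image emb_inj[OF e])
  qed
  then show ?thesis using x P by simp
qed

lemma root_power_q:
  assumes "poly (map_poly e a) x = 0"
  shows "poly (map_poly e a) (x ^ q) = 0"
proof -
  have "map_poly (\<lambda>x. x ^ q) (map_poly e a) = map_poly e a"
    by (rule poly_eqI) (use q_pos in \<open>simp add: coeff_map_poly emb_power_q emb_0[OF e]\<close>)
  then show ?thesis
    using emb_poly[OF frobenius_emb, of "map_poly e a" x] assms q_pos by (simp add: power_0_left)
qed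

lemma root_coset:
  assumes "poly (map_poly e a) (\<beta> ^ s) = 0" "i \<in> C s"
  shows "poly (map_poly e a) (\<beta> ^ i) = 0"
proof -
  have *: "poly (map_poly e a) (\<beta> ^ (s * q ^ j)) = 0" for j
  proof (induction j)
    case (Suc j)
    have "(\<beta> ^ (s * q ^ j)) ^ q = \<beta> ^ (s * q ^ Suc j)" by (simp add: mult_ac flip: power_mult)
    then show ?case using root_power_q[OF Suc] by simp
  qed (use assms in simp)
  obtain j where "i = (s * q ^ j) mod N" using assms(2) by (auto simp: cyc_coset_def)
  then show ?thesis using * \<beta>_mod by simp
qed

text \<open>For \<open>r = 2 * \<delta>' - 3\<close> this is the defining set of the code, closed
  under multiplication by \<open>q\<close>.\<close>

definition covered :: "nat \<Rightarrow> nat set" where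
  "covered r = {i. odd i \<and> i < N \<and> (\<exists>s. odd s \<and> s \<le> r \<and> i \<in> C s)}"

lemma finite_covered: "finite (covered r)"
  by (rule finite_subset[of _ "{..<N}"]) (auto simp: covered_def)

lemma card_covered:
  assumes "odd r"
  shows "card (covered r) + (\<Sum>l\<in>{l \<in> A. r < l}. card (C l)) = n"
proof -
  let ?O = "{i. odd i \<and> i < N}"
  have "bij_betw (\<lambda>k. 2 * k + 1) {..<n} ?O"
    by (rule bij_betwI[where g = "\<lambda>i. i div 2"]) (use N_2n in auto)
  then have "card ?O = n" using bij_betw_same_card by fastforce
  moreover have "?O = covered r \<union> (\<Union>l\<in>{l \<in> A. r < l}. C l)"
    unfolding uncovered_exponents[OF assms, symmetric] covered_def by auto
  moreover have "covered r \<inter> (\<Union>l\<in>{l \<in> A. r < l}. C l) = {}"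
    unfolding uncovered_exponents[OF assms, symmetric] covered_def by auto
  moreover have "finite (\<Union>l\<in>{l \<in> A. r < l}. C l)" using finite_odd_leaders finite_coset by auto
  moreover have "card (\<Union>l\<in>{l \<in> A. r < l}. C l) = (\<Sum>l\<in>{l \<in> A. r < l}. card (C l))"
    by (rule card_UN_cosets) auto
  ultimately show ?thesis using card_Un_disjoint[OF finite_covered] by metis
qed

text \<open>Multiplication by \<open>q\<close> permutes the exponents, so Frobenius fixes the
  product of the linear factors and its coefficients descend to the small field. This bounds the
  degree of the generator from above without factoring the \<open>Lcm\<close>.\<close>

lemma ex_poly_covered: "\<exists>h. h \<noteq> 0 \<and> degree h = card (covered r) \<and> (\<forall>i\<in>covered r. poly (map_poly e h) (\<beta> ^ i) = 0)"
proof -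
  define H where "H = (\<Prod>i\<in>covered r. [:- (\<beta> ^ i), 1:])"
  have inj: "inj_on (\<lambda>i. (i * q) mod N) (covered r)"
  proof (rule inj_onI)
    fix i j assume ij: "i \<in> covered r" "j \<in> covered r" "(i * q) mod N = (j * q) mod N"
    then have "[i * q = j * q] (mod N)" by (simp add: cong_def)
    then have "[i = j] (mod N)" using cong_mult_rcancel_nat[of q N] coprime_q_N[of 1] by simp
    then show "i = j" using ij by (simp add: cong_def covered_def)
  qed
  have closed: "(\<lambda>i. (i * q) mod N) ` covered r \<subseteq> covered r"
  proof (intro image_subsetI)
    fix i assume "i \<in> covered r"
    then obtain s where s: "odd s" "s \<le> r" "i \<in> C s" by (auto simp: covered_def)
    then have "(i * q) mod N \<in> C s" using coset_power_closed by blast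
    then show "(i * q) mod N \<in> covered r" using s coset_odd coset_subset by (auto simp: covered_def)
  qed
  have surj: "(\<lambda>i. (i * q) mod N) ` covered r = covered r"
    using endo_inj_surj[OF finite_covered closed inj] .
  have "map_poly (\<lambda>x. x ^ q) H = (\<Prod>i\<in>covered r. [:- (\<beta> ^ (i * q)), 1:])"
    unfolding H_def map_poly_emb_prod[OF frobenius_emb]
    using emb_uminus[OF frobenius_emb] q_pos by (simp add: map_poly_pCons power_0_left flip: power_mult)
  also have "\<dots> = (\<Prod>i\<in>covered r. [:- (\<beta> ^ ((i * q) mod N)), 1:])" by (simp add: \<beta>_mod)
  also have "\<dots> = (\<Prod>i\<in>(\<lambda>i. (i * q) mod N) ` covered r. [:- (\<beta> ^ i), 1:])"
    using prod.reindex[OF inj, of "\<lambda>i. [:- (\<beta> ^ i), 1:]"] by (simp add: o_def)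
  also have "\<dots> = H" unfolding surj H_def ..
  finally have fixed: "map_poly (\<lambda>x. x ^ q) H = H" .
  define h where "h = map_poly (inv_into UNIV e) H"
  have inv0: "inv_into UNIV e 0 = 0" using emb_inj[OF e] emb_0[OF e] by (metis inv_f_f)
  have "map_poly e h = H"
  proof (rule poly_eqI)
    fix i
    have "Polynomial.coeff H i ^ q = Polynomial.coeff H i"
      using arg_cong[OF fixed, of "\<lambda>p. Polynomial.coeff p i"] q_pos by (simp add: coeff_map_poly power_0_left)
    then have "Polynomial.coeff H i \<in> range e" by (rule fixed_by_frobenius)
    then show "Polynomial.coeff (map_poly e h) i = Polynomial.coeff H i"
      unfolding h_def by (simp add: coeff_map_poly inv0 emb_0[OF e] f_inv_into_f)
  qed
  moreover have "degree H = card (covered r)"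
    unfolding H_def by (subst degree_prod_eq_sum_degree) auto
  moreover have "H \<noteq> 0" unfolding H_def using finite_covered by simp
  moreover have "poly H (\<beta> ^ i) = 0" if "i \<in> covered r" for i
    using that finite_covered unfolding H_def poly_prod by (intro prod_zero) auto
  ultimately show ?thesis
    using degree_map_poly_emb[OF e, of h] map_poly_emb_eq_0_iff[OF e, of h] by (intro exI[of _ h]) auto
qed

section \<open>Generator, dimension and distance\<close>

definition modulus :: "'a poly" where "modulus = [:0, 1:] ^ n + 1"

lemma modulus: "modulus \<noteq> 0" "degree modulus = n"
    "odd i \<Longrightarrow> poly (map_poly e modulus) (\<beta> ^ i) = 0"
proof -
  have m: "modulus = Polynomial.monom 1 n + Polynomial.monom 1 0"
    by (simp add: modulus_def monom_altdef)
  have "degree (Polynomial.monom (1 :: 'a) 0) < degree (Polynomial.monom (1 :: 'a) n)"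
    using n_pos by (simp add: degree_monom_eq)
  then show deg: "degree modulus = n" unfolding m by (simp add: degree_add_eq_left degree_monom_eq)
  show "modulus \<noteq> 0" using deg n_pos by auto
  assume "odd i"
  then show "poly (map_poly e modulus) (\<beta> ^ i) = 0"
    unfolding m map_poly_emb_add[OF e]
    by (simp add: map_poly_monom emb_0[OF e] emb_1[OF e] poly_monom \<beta>_n)
qed

lemma gen_dvd_iff:
  "negabch_gen e \<beta> \<delta>' dvd a \<longleftrightarrow> (\<forall>i\<in>covered (1 + 2 * (\<delta>' - 2)). poly (map_poly e a) (\<beta> ^ i) = 0)"
proof -
  have mp: "min_poly e (\<beta> ^ (1 + 2 * s)) dvd a \<longleftrightarrow> poly (map_poly e a) (\<beta> ^ (1 + 2 * s)) = 0" for s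
    by (rule min_poly_dvd_iff[OF e modulus(1) modulus(3)]) simp
  have "negabch_gen e \<beta> \<delta>' dvd a \<longleftrightarrow> (\<forall>s\<le>\<delta>' - 2. poly (map_poly e a) (\<beta> ^ (1 + 2 * s)) = 0)"
    unfolding negabch_gen_def Lcm_dvd_iff using mp by auto
  also have "\<dots> \<longleftrightarrow> (\<forall>i\<in>covered (1 + 2 * (\<delta>' - 2)). poly (map_poly e a) (\<beta> ^ i) = 0)"
  proof (intro iffI allI ballI impI)
    fix i assume *: "\<forall>s\<le>\<delta>' - 2. poly (map_poly e a) (\<beta> ^ (1 + 2 * s)) = 0"
      and "i \<in> covered (1 + 2 * (\<delta>' - 2))"
    then obtain s where s: "odd s" "s \<le> 1 + 2 * (\<delta>' - 2)" "i \<in> C s" by (auto simp: covered_def)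
    then obtain t where "s = 1 + 2 * t" by (metis add.commute oddE)
    then show "poly (map_poly e a) (\<beta> ^ i) = 0" using s * by (intro root_coset[of a s i]) auto
  next
    fix s assume *: "\<forall>i\<in>covered (1 + 2 * (\<delta>' - 2)). poly (map_poly e a) (\<beta> ^ i) = 0" and s: "s \<le> \<delta>' - 2"
    \<comment> \<open>The exponent may exceed \<open>N\<close>; reduction keeps it odd, as
      \<open>N\<close> is even, and does not change the power of \<open>\<beta>\<close>.\<close>
    have "(1 + 2 * s) mod N \<in> C (1 + 2 * s)" unfolding cyc_coset_def by (auto intro!: exI[of _ 0])
    moreover from coset_odd[OF this] have "odd ((1 + 2 * s) mod N)" by simp
    ultimately have "(1 + 2 * s) mod N \<in> covered (1 + 2 * (\<delta>' - 2))"
      using s N_pos unfolding covered_def by (auto intro!: exI[of _ "1 + 2 * s"])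
    then show "poly (map_poly e a) (\<beta> ^ (1 + 2 * s)) = 0" using * \<beta>_mod[of "1 + 2 * s"] by metis
  qed
  finally show ?thesis .
qed

lemma gen_nonzero: "negabch_gen e \<beta> \<delta>' \<noteq> 0"
  and gen_dvd_modulus: "negabch_gen e \<beta> \<delta>' dvd modulus"
proof -
  show "negabch_gen e \<beta> \<delta>' dvd modulus"
    unfolding gen_dvd_iff using modulus(3) by (auto simp: covered_def)
  then show "negabch_gen e \<beta> \<delta>' \<noteq> 0" using modulus(1) by auto
qed

text \<open>Bounded above by the polynomial of \<open>ex_poly_covered\<close>, which the generator
  divides, and below by the number of distinct roots.\<close>

lemma degree_gen: "degree (negabch_gen e \<beta> \<delta>') = card (covered (1 + 2 * (\<delta>' - 2)))"
proof (rule antisym)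
  let ?Z = "covered (1 + 2 * (\<delta>' - 2))" and ?g = "negabch_gen e \<beta> \<delta>'"
  obtain h where h: "h \<noteq> 0" "degree h = card ?Z" "\<forall>i\<in>?Z. poly (map_poly e h) (\<beta> ^ i) = 0"
    using ex_poly_covered by blast
  then have "?g dvd h" by (simp add: gen_dvd_iff)
  then show "degree ?g \<le> card ?Z" using dvd_imp_degree_le h by metis
  let ?G = "map_poly e ?g"
  have "?G \<noteq> 0" using gen_nonzero map_poly_emb_eq_0_iff[OF e] by blast
  have "inj_on (\<lambda>i. \<beta> ^ i) ?Z" by (rule inj_on_subset[OF \<beta>_inj]) (auto simp: covered_def)
  then have "card ?Z = card ((\<lambda>i. \<beta> ^ i) ` ?Z)" by (simp add: card_image)
  also have "\<dots> \<le> card {x. poly ?G x = 0}"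
    by (rule card_mono) (use gen_dvd_iff[of \<delta>' ?g] in auto)
  also have "\<dots> \<le> degree ?G" using \<open>?G \<noteq> 0\<close> by (rule card_poly_roots_bound)
  finally show "card ?Z \<le> degree ?g" by (simp add: degree_map_poly_emb[OF e])
qed

text \<open>The generator divides the modulus, so taking remainders keeps multiples of it.\<close>

lemma code_eq: "negabch_code e \<beta> n \<delta>' = {c. negabch_gen e \<beta> \<delta>' dvd c \<and> c \<in> polys_below n}"
proof -
  let ?g = "negabch_gen e \<beta> \<delta>'"
  have "(?g * a) mod modulus \<in> polys_below n" for a
    using degree_mod_less[OF modulus(1), of "?g * a"] by (auto simp: polys_below_iff modulus(2))
  moreover have "?g dvd (?g * a) mod modulus" for a
    using gen_dvd_modulus by (simp add: dvd_mod)
  moreover have "\<exists>a. c = (?g * a) mod modulus" if "?g dvd c" "c \<in> polys_below n" for c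
  proof -
    obtain a where "c = ?g * a" using \<open>?g dvd c\<close> ..
    moreover have "c mod modulus = c"
      using that(2) modulus(2) by (cases "c = 0") (auto simp: polys_below_iff intro: mod_poly_less)
    ultimately show ?thesis by metis
  qed
  ultimately show ?thesis unfolding negabch_code_def modulus_def[symmetric] by auto
qed

text \<open>\<open>L\<close> says that the leaders left uncovered are exactly
  \<open>\<delta> 1\<close>, ..., \<open>\<delta> k\<close>. The results thus depend on
  \<open>k\<close> alone, and the distance bound comes from \<open>\<delta> k\<close>, not from the
  possibly smaller \<open>\<delta>'\<close>.\<close>

lemma code_properties:
  assumes k: "0 < k" "k \<le> card A"
    and L: "\<And>l. l \<in> A \<Longrightarrow> 1 + 2 * (\<delta>' - 2) < l \<longleftrightarrow> \<delta> k \<le> l"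
  shows "code_dim (negabch_code e \<beta> n \<delta>') = (\<Sum>j=1..k. card (C (\<delta> j)))"
    and "card (negabch_code e \<beta> n \<delta>') = q ^ (\<Sum>j=1..k. card (C (\<delta> j)))"
    and "(\<delta> k + 1) div 2 \<le> min_dist (negabch_code e \<beta> n \<delta>')"
proof -
  let ?g = "negabch_gen e \<beta> \<delta>'" and ?r = "1 + 2 * (\<delta>' - 2)" and ?D = "negabch_code e \<beta> n \<delta>'"
  note \<delta>k = \<delta>_props(1)[OF k]
  have "{l \<in> A. ?r < l} = insert (\<delta> k) {l \<in> A. \<delta> k < l}" using L \<delta>k by force
  also have "\<dots> = \<delta> ` insert k {1..<k}" unfolding greater_\<delta>[OF k] by simp
  also have "insert k {1..<k} = {1..k}" using k by auto
  finally have img: "{l \<in> A. ?r < l} = \<delta> ` {1..k}" .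
  have inj: "inj_on \<delta> {1..k}"
  proof (rule linorder_inj_onI)
    fix i j assume "i < j" "i \<in> {1..k}" "j \<in> {1..k}"
    then show "\<delta> i \<noteq> \<delta> j" using \<delta>_strict[of i j] k by simp
  qed auto
  define K where "K = (\<Sum>j=1..k. card (C (\<delta> j)))"
  have "card (covered ?r) + K = n"
    using card_covered[of ?r] unfolding img K_def sum.reindex[OF inj] by simp
  then have deg: "degree ?g \<le> n" "n - degree ?g = K" using degree_gen[of \<delta>'] by auto
  show "code_dim ?D = K" unfolding code_eq code_dim_multiples_below[OF gen_nonzero deg(1)] deg(2) ..
  show card: "card ?D = q ^ K"
    unfolding code_eq card_multiples_below[OF gen_nonzero deg(1)] deg(2) q_card ..
  \<comment> \<open>A size of at least 3 makes the code finite with a nonzero word, so that the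
    \<open>Min\<close> in \<open>min_dist\<close> is meaningful.\<close>
  have "card (C (\<delta> k)) \<le> K" unfolding K_def using k by (intro member_le_sum) auto
  moreover have "0 < card (C (\<delta> k))"
    using finite_coset coset_refl[of "\<delta> k"] \<delta>k by (auto simp: odd_leader_iff card_gt_0_iff)
  ultimately have "3 \<le> q ^ K" using q_power_ge[of K] by simp
  then have "3 \<le> card ?D" using card by simp
  then have finD: "finite ?D" using card.infinite by fastforce
  have "\<exists>c\<in>?D. c \<noteq> 0"
  proof (rule ccontr)
    assume "\<not> (\<exists>c\<in>?D. c \<noteq> 0)"
    then have "?D \<subseteq> {0}" by auto
    then have "card ?D \<le> 1" using card_mono[of "{0}" ?D] by simp
    then show False using \<open>3 \<le> card ?D\<close> by simp
  qed
  moreover have "(\<delta> k + 1) div 2 \<le> hamming_wt c" if c: "c \<in> ?D" "c \<noteq> 0" for c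
  proof -
    have odd\<delta>: "odd (\<delta> k)" using \<delta>k by (simp add: odd_leader_iff)
    \<comment> \<open>The odd numbers below \<open>\<delta> k\<close> are
      \<open>(\<delta> k - 1) div 2\<close> consecutive zeros: the leader of each is below
      \<open>\<delta> k\<close>, hence covered.\<close>
    have "(\<delta> k - 1) div 2 < hamming_wt c"
    proof (rule bch_bound[OF e \<beta>_nonzero])
      show "inj_on (\<lambda>i. (\<beta>\<^sup>2) ^ i) {..<n}"
      proof (rule inj_onI)
        fix i j assume ij: "i \<in> {..<n}" "j \<in> {..<n}" "(\<beta>\<^sup>2) ^ i = (\<beta>\<^sup>2) ^ j"
        then have "2 * i = 2 * j"
          by (intro inj_onD[OF \<beta>_inj]) (auto simp: N_2n power_mult)
        then show "i = j" by simp
      qed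
      show "c \<noteq> 0" "c \<in> polys_below n" using c code_eq by auto
      fix s assume "s < (\<delta> k - 1) div 2"
      then have s: "1 + 2 * s < \<delta> k" by linarith
      then have sN: "1 + 2 * s < N" using \<delta>k by (auto simp: odd_leader_iff)
      obtain l where l: "l \<in> A" "1 + 2 * s \<in> C l" using ex_leader[of "1 + 2 * s"] sN by auto
      have "l < \<delta> k" using odd_leader_le[OF l] s by simp
      then have "l \<le> ?r" using L[OF l(1)] by simp
      then have "1 + 2 * s \<in> covered ?r" using l sN by (auto simp: covered_def odd_leader_iff)
      then show "poly (map_poly e c) (\<beta> ^ (1 + 2 * s)) = 0"
        using c(1) unfolding code_eq gen_dvd_iff by blast
    qed
    then show ?thesis using odd\<delta> by (auto elim!: oddE)
  qed
  ultimately show "(\<delta> k + 1) div 2 \<le> min_dist ?D"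
    unfolding min_dist_def using finD by (subst Min_ge_iff) auto
qed

lemma min_dist_le:
  assumes "card (negabch_code e \<beta> n \<delta>') = q ^ m"
  shows "2 * min_dist (negabch_code e \<beta> n \<delta>') \<le> (q - 1) * q ^ (m - 1)"
proof -
  let ?D = "negabch_code e \<beta> n \<delta>'"
  have qm: "q ^ m = q * q ^ (m - 1)" using m_ge by (simp add: power_eq_if)
  have "card ?D \<noteq> 1" "card ?D \<noteq> 0" unfolding assms using Suc_N N_ge by linarith+
  then have "finite ?D" "?D \<noteq> {0}" by (auto intro: card_ge_0_finite)
  then have "q * (card ?D - 1) * min_dist ?D \<le> n * ((q - 1) * card ?D)"
    unfolding q_card[symmetric]
    by (intro min_dist_average) (auto simp: code_eq polys_below_def)
  moreover have "card ?D - 1 = N" using assms Suc_N by simp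
  ultimately have "q * N * min_dist ?D \<le> n * ((q - 1) * (q * q ^ (m - 1)))"
    using assms qm by simp
  then have "(n * q) * (2 * min_dist ?D) \<le> (n * q) * ((q - 1) * q ^ (m - 1))"
    unfolding N_2n by (simp add: mult_ac)
  then show ?thesis using n_pos q_pos by simp
qed

lemma parameters:
  fixes \<delta>' :: nat
  defines "\<kappa> \<equiv> (if m mod 3 = 0 then m div 3 else m)"
  shows "2 \<le> \<delta>' \<Longrightarrow> (\<delta> 2 + 3) div 2 \<le> \<delta>' \<Longrightarrow> \<delta>' \<le> (\<delta> 1 + 1) div 2 \<Longrightarrow>
        code_dim (negabch_code e \<beta> n \<delta>') = m \<and> min_dist (negabch_code e \<beta> n \<delta>') = (\<delta> 1 + 1) div 2"
    and "2 \<le> \<delta>' \<Longrightarrow> (\<delta> 3 + 3) div 2 \<le> \<delta>' \<Longrightarrow> \<delta>' \<le> (\<delta> 2 + 1) div 2 \<Longrightarrow>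
        code_dim (negabch_code e \<beta> n \<delta>') = m + \<kappa> \<and> min_dist (negabch_code e \<beta> n \<delta>') \<ge> (\<delta> 2 + 1) div 2"
    and "25 \<le> q ^ m \<Longrightarrow>
        code_dim (negabch_code e \<beta> n ((\<delta> 3 + 1) div 2)) = 2 * m + \<kappa> \<and>
        min_dist (negabch_code e \<beta> n ((\<delta> 3 + 1) div 2)) \<ge> (\<delta> 3 + 1) div 2"
proof -
  define d1 d2 d3 where d_def: "d1 = \<delta> 1" "d2 = \<delta> 2" "d3 = \<delta> 3"
  have c2: "2 \<le> card A" and c1: "1 \<le> card A" using card_odd_leaders(1) by auto
  have A12: "d1 \<in> A" "d2 \<in> A" unfolding d_def by (rule \<delta>_props(1); use c1 c2 in simp)+
  then have odd: "odd d1" "odd d2" by (auto simp: odd_leader_iff)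
  have lt21: "d2 < d1" unfolding d_def by (rule \<delta>_strict) (use c2 in auto)
  have "{1..<2 :: nat} = {1}" by auto
  then have above2: "{l \<in> A. d2 < l} = {d1}"
    using greater_\<delta>[OF pos2 c2] unfolding d_def by simp
  have sum1: "(\<Sum>j=1..1. card (C (\<delta> j))) = m" using \<delta>1(2) by simp
  have "{1..2 :: nat} = {1, 2}" by auto
  then have "(\<Sum>j=1..2. card (C (\<delta> j))) = card (C (\<delta> 1)) + card (C (\<delta> 2))" by simp
  then have sum2: "(\<Sum>j=1..2. card (C (\<delta> j))) = m + \<kappa>"
    unfolding \<delta>1(2) \<delta>2 \<kappa>_def .
  show "code_dim (negabch_code e \<beta> n \<delta>') = m \<and> min_dist (negabch_code e \<beta> n \<delta>') = (\<delta> 1 + 1) div 2"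
    if "2 \<le> \<delta>'" "(\<delta> 2 + 3) div 2 \<le> \<delta>'" "\<delta>' \<le> (\<delta> 1 + 1) div 2"
  proof -
    note * = that[folded d_def]
    \<comment> \<open>As leaders are odd, the range of \<open>\<delta>'\<close> means
      \<open>d2 \<le> 2 * \<delta>' - 3 < d1\<close>.\<close>
    have L: "1 + 2 * (\<delta>' - 2) < l \<longleftrightarrow> \<delta> 1 \<le> l" if l: "l \<in> A" for l
      unfolding d_def[symmetric]
    proof
      assume "1 + 2 * (\<delta>' - 2) < l"
      then have "d2 < l" using * odd by presburger
      then have "l \<in> {l \<in> A. d2 < l}" using l by simp
      then show "d1 \<le> l" unfolding above2 by simp
    next
      assume "d1 \<le> l"
      then show "1 + 2 * (\<delta>' - 2) < l" using * odd by presburger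
    qed
    note code = code_properties[OF zero_less_one c1 L, unfolded sum1]
    have "2 * min_dist (negabch_code e \<beta> n \<delta>') \<le> (q - 1) * q ^ (m - 1)"
      by (rule min_dist_le) (rule code(2))
    \<comment> \<open>The average bound and the BCH bound meet here.\<close>
    also have "\<dots> = \<delta> 1 + 1"
    proof -
      have "q ^ m = q * q ^ (m - 1)" using m_ge by (simp add: power_eq_if)
      moreover have "0 < q ^ (m - 1)" "3 * q ^ (m - 1) \<le> q * q ^ (m - 1)" using q_ge by auto
      ultimately show ?thesis unfolding \<delta>1(1) diff_mult_distrib using Suc_N by linarith
    qed
    finally have "min_dist (negabch_code e \<beta> n \<delta>') \<le> (\<delta> 1 + 1) div 2" by linarith
    moreover have "(\<delta> 1 + 1) div 2 \<le> min_dist (negabch_code e \<beta> n \<delta>')" by (rule code(3))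
    moreover have "code_dim (negabch_code e \<beta> n \<delta>') = m" by (rule code(1))
    ultimately show ?thesis by linarith
  qed
  show "code_dim (negabch_code e \<beta> n ((\<delta> 3 + 1) div 2)) = 2 * m + \<kappa> \<and>
      min_dist (negabch_code e \<beta> n ((\<delta> 3 + 1) div 2)) \<ge> (\<delta> 3 + 1) div 2" if large: "25 \<le> q ^ m"
  proof -
    have c3: "3 \<le> card A" using large by (rule card_odd_leaders(2))
    have "d3 \<in> A" unfolding d_def by (rule \<delta>_props(1)[OF _ c3]) simp
    then have odd3: "odd d3" by (simp add: odd_leader_iff)
    have d3: "3 \<le> d3" unfolding d_def using large by (rule \<delta>3(2))
    \<comment> \<open>The left side is \<open>\<delta> 3 - 2\<close>; \<open>d3 \<ge> 3\<close>
      keeps the subtraction from truncating.\<close>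
    have L: "1 + 2 * ((\<delta> 3 + 1) div 2 - 2) < l \<longleftrightarrow> \<delta> 3 \<le> l" if "l \<in> A" for l
    proof -
      have "odd l" using that by (simp add: odd_leader_iff)
      then show ?thesis unfolding d_def[symmetric] using odd3 d3 by presburger
    qed
    have "(\<Sum>j=1..3. card (C (\<delta> j))) = (\<Sum>j=1..2. card (C (\<delta> j))) + card (C (\<delta> 3))"
    proof -
      have "{1..3 :: nat} = insert 3 {1..2}" by auto
      then show ?thesis by simp
    qed
    also have "\<dots> = 2 * m + \<kappa>" unfolding sum2 \<delta>3(1)[OF large] by simp
    finally show ?thesis using code_properties[OF _ c3 L] by simp
  qed
  show "code_dim (negabch_code e \<beta> n \<delta>') = m + \<kappa> \<and> (\<delta> 2 + 1) div 2 \<le> min_dist (negabch_code e \<beta> n \<delta>')"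
    if "2 \<le> \<delta>'" "(\<delta> 3 + 3) div 2 \<le> \<delta>'" "\<delta>' \<le> (\<delta> 2 + 1) div 2"
  proof -
    note * = that[folded d_def]
    have large: "25 \<le> q ^ m"
    proof (rule ccontr)
      assume "\<not> 25 \<le> q ^ m"
      then have "\<delta> 2 < 3" by (intro \<delta>2_small) simp
      then show False using that by simp
    qed
    have c3: "3 \<le> card A" using large by (rule card_odd_leaders(2))
    have "d3 \<in> A" unfolding d_def by (rule \<delta>_props(1)[OF _ c3]) simp
    then have odd3: "odd d3" by (simp add: odd_leader_iff)
    have "{1..<3 :: nat} = {1, 2}" by auto
    then have above3: "{l \<in> A. d3 < l} = {d1, d2}"
      using greater_\<delta>[OF _ c3] unfolding d_def by simp
    have L: "1 + 2 * (\<delta>' - 2) < l \<longleftrightarrow> \<delta> 2 \<le> l" if l: "l \<in> A" for l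
      unfolding d_def[symmetric]
    proof
      assume "1 + 2 * (\<delta>' - 2) < l"
      then have "d3 < l" using * odd3 by presburger
      then have "l \<in> {l \<in> A. d3 < l}" using l by simp
      then show "d2 \<le> l" unfolding above3 using lt21 by auto
    next
      assume "d2 \<le> l"
      then show "1 + 2 * (\<delta>' - 2) < l" using * odd by presburger
    qed
    then show ?thesis using code_properties[OF _ c2 L] sum2 by simp
  qed
qed

end

theorem theorem21:
  fixes q m n \<delta> :: nat
    and e :: "'a::{field_gcd,finite} \<Rightarrow> 'b::{field,finite}"
    and \<alpha> \<beta> :: 'b
  assumes q_card: "card (UNIV :: 'a set) = q"
    and q_pp: "\<exists>p k. prime p \<and> 0 < k \<and> q = p ^ k"
    and q_odd: "odd q"
    and m: "m \<ge> 2"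
    and n: "n = (q ^ m - 1) div 2"
    and b_card: "card (UNIV :: 'b set) = q ^ ord (2 * n) q"
    and emb: "field_emb e"
    and alpha: "primitive_element \<alpha>"
    and beta: "\<beta> = \<alpha> ^ ((card (UNIV :: 'b set) - 1) div (2 * n))"
  defines "\<delta>1 \<equiv> odd_leader_delta q (q ^ m - 1) 1"
    and "\<delta>2 \<equiv> odd_leader_delta q (q ^ m - 1) 2"
    and "\<delta>3 \<equiv> odd_leader_delta q (q ^ m - 1) 3"
    and "\<kappa> \<equiv> (if m mod 3 = 0 then m div 3 else m)"
  shows "(2 \<le> \<delta> \<and> (\<delta>2 + 3) div 2 \<le> \<delta> \<and> \<delta> \<le> (\<delta>1 + 1) div 2 \<longrightarrow>
            code_dim (negabch_code e \<beta> n \<delta>) = m \<and>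
            min_dist (negabch_code e \<beta> n \<delta>) = (\<delta>1 + 1) div 2)
       \<and> (2 \<le> \<delta> \<and> (\<delta>3 + 3) div 2 \<le> \<delta> \<and> \<delta> \<le> (\<delta>2 + 1) div 2 \<longrightarrow>
            code_dim (negabch_code e \<beta> n \<delta>) = m + \<kappa> \<and>
            min_dist (negabch_code e \<beta> n \<delta>) \<ge> (\<delta>2 + 1) div 2)
       \<and> (q ^ m \<ge> 25 \<longrightarrow>
            code_dim (negabch_code e \<beta> n ((\<delta>3 + 1) div 2)) = 2 * m + \<kappa> \<and>
            min_dist (negabch_code e \<beta> n ((\<delta>3 + 1) div 2)) \<ge> (\<delta>3 + 1) div 2)"
proof -
  obtain p k where pk: "prime p" "0 < k" "q = p ^ k" using q_pp by blast
  have "1 < q" unfolding pk(3) using pk prime_gt_1_nat[OF pk(1)] by (intro one_less_power)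
  then have q3: "q \<ge> 3" using q_odd by presburger
  interpret odd_cyclotomy q m "q ^ m - 1"
    by standard (use q_odd q3 m in auto)
  have N: "q ^ m - 1 = 2 * n" using even_N n by simp
  have "ord (2 * n) q = m"
    unfolding N[symmetric] by (rule ord_power_minus_one) (use q3 m in auto)
  then have b: "card (UNIV :: 'b set) = q ^ m" using b_card by simp
  \<comment> \<open>Since \<open>2 * n\<close> is the full order \<open>q ^ m - 1\<close>, the
    exponent is 1.\<close>
  have "\<beta> = \<alpha> ^ ((q ^ m - 1) div (q ^ m - 1))" using beta b N by simp
  then have \<beta>\<alpha>: "\<beta> = \<alpha>" using N_pos by simp
  have "2 < card (UNIV :: 'b set)" unfolding b using Suc_N N_ge by linarith
  note \<alpha> = primitive_element_powers[OF alpha this, unfolded b]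
  interpret negacyclic_bch q m "q ^ m - 1" e \<beta> n
    using emb q_card b q_pp N \<alpha> unfolding \<beta>\<alpha> by unfold_locales
  show ?thesis
    unfolding \<delta>1_def \<delta>2_def \<delta>3_def \<kappa>_def using parameters by blast
qed

end
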